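(* Let $(M,g,J)$ be a connected Kähler-Einstein surface (real dimension $4$), oriented so that $J$ is positive. Then any positive, orthogonal almost-Kähler structure $J'$ on $(M,g)$ is integrable. In particular, $J'=J$ or $J'=-J$ on $M$ whenever $g$ has non-vanishing scalar curvature.
   Context: All objects are smooth; $M$ is not assumed compact, nor $g$ complete. A Kähler-Einstein surface $(M,g,J)$ is a Kähler manifold of real dimension $4$ whose metric $g$ is Einstein. An orthogonal almost-Kähler structure on a Riemannian four-manifold $(M,g)$ is an almost complex structure $J'$ that is orthogonal with respect to $g$ (i.e. $g(J'X,J'Y)=g(X,Y)$) and such that the two-form $\omega_{J'}=g(J'\cdot,\cdot)$ is closed (integrability of $J'$ is not required, nor excluded). $J'$ is called positive if it induces the given orientation of $M$, here the one induced by $J$. $J'$ is integrable if its Nijenhuis tensor vanishes (equivalently, $(M,g,J')$ is Kähler). *)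

theory Defs
  imports "HOL-Analysis.Analysis"
begin

section \<open>Local calculus on open subsets of Euclidean space\<close>

text \<open>Iterated directional differentiability; meaningful on open sets of a Euclidean space, which is
  the only place it is used.\<close>

primrec Ck_on :: "nat \<Rightarrow> ('a::euclidean_space \<Rightarrow> 'b::real_normed_vector) \<Rightarrow> 'a set \<Rightarrow> bool" where
  "Ck_on 0 f S \<longleftrightarrow> continuous_on S f"
| "Ck_on (Suc k) f S \<longleftrightarrow>
     (\<forall>x\<in>S. f differentiable (at x)) \<and> (\<forall>v. Ck_on k (\<lambda>x. frechet_derivative f (at x) v) S)"

definition smooth_on :: "('a::euclidean_space \<Rightarrow> 'b::real_normed_vector) \<Rightarrow> 'a set \<Rightarrow> bool" where
  "smooth_on f S \<longleftrightarrow> (\<forall>k. Ck_on k f S)"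

definition partial :: "'n::finite \<Rightarrow> (real^'n \<Rightarrow> 'b::real_normed_vector) \<Rightarrow> real^'n \<Rightarrow> 'b" where
  "partial i f x = frechet_derivative f (at x) (axis i 1)"

text \<open>A bilinear form with coefficient matrix \<open>B\<close>, so that \<open>B $ i $ j = form B \<partial>\<^sub>i \<partial>\<^sub>j\<close>.\<close>

definition form :: "real^'n^'n \<Rightarrow> real^'n \<Rightarrow> real^'n \<Rightarrow> real" where
  "form B u v = u \<bullet> (B *v v)"

definition christoffel :: "(real^'n \<Rightarrow> real^'n^'n) \<Rightarrow> 'n \<Rightarrow> 'n \<Rightarrow> 'n \<Rightarrow> real^'n \<Rightarrow> real" where
  "christoffel g k i j x =
     1/2 * (\<Sum>l\<in>UNIV. matrix_inv (g x) $ k $ l *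
        (partial i (\<lambda>y. g y $ j $ l) x + partial j (\<lambda>y. g y $ i $ l) x
          - partial l (\<lambda>y. g y $ i $ j) x))"

text \<open>\<open>riemann g l k i j\<close> is the coefficient of \<open>\<partial>\<^sub>l\<close> in \<open>R(\<partial>\<^sub>i,\<partial>\<^sub>j)\<partial>\<^sub>k\<close>, where
  \<open>R(X,Y)Z = \<nabla>\<^sub>X\<nabla>\<^sub>YZ - \<nabla>\<^sub>Y\<nabla>\<^sub>XZ - \<nabla>\<^bsub>[X,Y]\<^esub>Z\<close>.\<close>

definition riemann :: "(real^'n \<Rightarrow> real^'n^'n) \<Rightarrow> 'n \<Rightarrow> 'n \<Rightarrow> 'n \<Rightarrow> 'n \<Rightarrow> real^'n \<Rightarrow> real" where
  "riemann g l k i j x =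
     partial i (christoffel g l j k) x - partial j (christoffel g l i k) x
     + (\<Sum>m\<in>UNIV. christoffel g l i m x * christoffel g m j k x
                  - christoffel g l j m x * christoffel g m i k x)"

text \<open>\<open>Ric(Y,Z) = tr (X \<mapsto> R(X,Y)Z)\<close>; with these signs round spheres have positive Ricci curvature.\<close>

definition ricci :: "(real^'n \<Rightarrow> real^'n^'n) \<Rightarrow> real^'n \<Rightarrow> real^'n^'n" where
  "ricci g x = (\<chi> j k. \<Sum>i\<in>UNIV. riemann g i k i j x)"

definition scalar_curvature :: "(real^'n \<Rightarrow> real^'n^'n) \<Rightarrow> real^'n \<Rightarrow> real" where
  "scalar_curvature g x = (\<Sum>i\<in>UNIV. \<Sum>j\<in>UNIV. matrix_inv (g x) $ i $ j * ricci g x $ i $ j)"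

definition lie_bracket ::
  "(real^'n \<Rightarrow> real^'n) \<Rightarrow> (real^'n \<Rightarrow> real^'n) \<Rightarrow> real^'n \<Rightarrow> real^'n" where
  "lie_bracket X Y x = frechet_derivative Y (at x) (X x) - frechet_derivative X (at x) (Y x)"

definition nijenhuis ::
  "(real^'n \<Rightarrow> real^'n^'n) \<Rightarrow> (real^'n \<Rightarrow> real^'n) \<Rightarrow> (real^'n \<Rightarrow> real^'n) \<Rightarrow> real^'n \<Rightarrow> real^'n" where
  "nijenhuis J X Y x =
     lie_bracket (\<lambda>y. J y *v X y) (\<lambda>y. J y *v Y y) x
     - J x *v lie_bracket (\<lambda>y. J y *v X y) Y x
     - J x *v lie_bracket X (\<lambda>y. J y *v Y y) x
     - lie_bracket X Y x"

text \<open>The exterior derivative of the two-form with coefficients \<open>w $ i $ j\<close>, evaluated on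
  \<open>\<partial>\<^sub>i, \<partial>\<^sub>j, \<partial>\<^sub>k\<close>.\<close>

definition ext_deriv2 :: "(real^'n \<Rightarrow> real^'n^'n) \<Rightarrow> 'n \<Rightarrow> 'n \<Rightarrow> 'n \<Rightarrow> real^'n \<Rightarrow> real" where
  "ext_deriv2 w i j k x =
     partial i (\<lambda>y. w y $ j $ k) x + partial j (\<lambda>y. w y $ k $ i) x + partial k (\<lambda>y. w y $ i $ j) x"


section \<open>Smooth four-manifolds\<close>

text \<open>A chart is a domain together with a coordinate map; values of the map outside its domain
  are irrelevant.\<close>

type_synonym 'a chart = "'a set \<times> ('a \<Rightarrow> real^4)"

definition coords :: "'a chart \<Rightarrow> (real^4) set" where
  "coords c = snd c ` fst c"

definition is_chart :: "'a topology \<Rightarrow> 'a chart \<Rightarrow> bool" where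
  "is_chart M c \<longleftrightarrow> openin M (fst c) \<and> open (coords c) \<and>
     homeomorphic_map (subtopology M (fst c)) (top_of_set (coords c)) (snd c)"

definition overlap :: "'a chart \<Rightarrow> 'a chart \<Rightarrow> (real^4) set" where
  "overlap c c' = snd c ` (fst c \<inter> fst c')"

definition transition :: "'a chart \<Rightarrow> 'a chart \<Rightarrow> real^4 \<Rightarrow> real^4" where
  "transition c c' x = snd c' (inv_into (fst c) (snd c) x)"

abbreviation transition_jacobian :: "'a chart \<Rightarrow> 'a chart \<Rightarrow> real^4 \<Rightarrow> real^4^4" where
  "transition_jacobian c c' x \<equiv> jacobian (transition c c') (at x)"

definition smooth_four_manifold :: "'a topology \<Rightarrow> 'a chart set \<Rightarrow> bool" where
  "smooth_four_manifold M A \<longleftrightarrow>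
     Hausdorff_space M \<and> second_countable M \<and>
     (\<forall>c\<in>A. is_chart M c) \<and> (\<Union>c\<in>A. fst c) = topspace M \<and>
     (\<forall>c\<in>A. \<forall>c'\<in>A. smooth_on (transition c c') (overlap c c'))"

text \<open>A tensor field of rank two is given by its matrix of coefficients in every chart of the atlas,
  as a function of the coordinates, subject to the transformation law of its type. Values at points
  outside \<open>coords c\<close> are irrelevant.\<close>

type_synonym 'a coefficients = "'a chart \<Rightarrow> real^4 \<Rightarrow> real^4^4"

definition covariant_tensor :: "'a chart set \<Rightarrow> 'a coefficients \<Rightarrow> bool" where
  "covariant_tensor A b \<longleftrightarrow>
     (\<forall>c\<in>A. smooth_on (b c) (coords c)) \<and>
     (\<forall>c\<in>A. \<forall>c'\<in>A. \<forall>x\<in>overlap c c'. \<forall>u v.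
        form (b c x) u v =
        form (b c' (transition c c' x)) (transition_jacobian c c' x *v u)
                                        (transition_jacobian c c' x *v v))"

definition endomorphism_field :: "'a chart set \<Rightarrow> 'a coefficients \<Rightarrow> bool" where
  "endomorphism_field A J \<longleftrightarrow>
     (\<forall>c\<in>A. smooth_on (J c) (coords c)) \<and>
     (\<forall>c\<in>A. \<forall>c'\<in>A. \<forall>x\<in>overlap c c'. \<forall>v.
        transition_jacobian c c' x *v (J c x *v v) =
        J c' (transition c c' x) *v (transition_jacobian c c' x *v v))"

definition riemannian_metric :: "'a chart set \<Rightarrow> 'a coefficients \<Rightarrow> bool" where
  "riemannian_metric A g \<longleftrightarrow> covariant_tensor A g \<and>
     (\<forall>c\<in>A. \<forall>x\<in>coords c.
        (\<forall>u v. form (g c x) u v = form (g c x) v u) \<and> (\<forall>v. v \<noteq> 0 \<longrightarrow> form (g c x) v v > 0))"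

definition einstein :: "'a chart set \<Rightarrow> 'a coefficients \<Rightarrow> bool" where
  "einstein A g \<longleftrightarrow> (\<exists>k::real. \<forall>c\<in>A. \<forall>x\<in>coords c. ricci (g c) x = k *\<^sub>R g c x)"

text \<open>An orientation is a choice of sign in each chart: \<open>+1\<close> where the coordinate basis is positively
  oriented and \<open>-1\<close> where it is negatively oriented. The charts of the atlas need neither be
  connected nor compatible with the orientation.\<close>

definition orientation :: "'a chart set \<Rightarrow> ('a chart \<Rightarrow> real^4 \<Rightarrow> real) \<Rightarrow> bool" where
  "orientation A ori \<longleftrightarrow>
     (\<forall>c\<in>A. continuous_on (coords c) (ori c) \<and> (\<forall>x\<in>coords c. ori c x = 1 \<or> ori c x = -1)) \<and>
     (\<forall>c\<in>A. \<forall>c'\<in>A. \<forall>x\<in>overlap c c'.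
        ori c x = sgn (det (transition_jacobian c c' x)) * ori c' (transition c c' x))"


section \<open>Almost complex structures\<close>

definition almost_complex :: "'a chart set \<Rightarrow> 'a coefficients \<Rightarrow> bool" where
  "almost_complex A J \<longleftrightarrow> endomorphism_field A J \<and>
     (\<forall>c\<in>A. \<forall>x\<in>coords c. \<forall>v. J c x *v (J c x *v v) = - v)"

text \<open>The orientation induced by \<open>J\<close> is the one for which all bases of the form
  \<open>u, J u, v, J v\<close> are positive.\<close>

definition positive_acs ::
  "'a chart set \<Rightarrow> ('a chart \<Rightarrow> real^4 \<Rightarrow> real) \<Rightarrow> 'a coefficients \<Rightarrow> bool" where
  "positive_acs A ori J \<longleftrightarrow>
     (\<forall>c\<in>A. \<forall>x\<in>coords c. \<forall>u v.
        let d = det (vector [u, J c x *v u, v, J c x *v v] :: real^4^4)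
        in d \<noteq> 0 \<longrightarrow> sgn d = ori c x)"

text \<open>The Nijenhuis tensor is tensorial, so it vanishes iff it does so on coordinate vector fields.\<close>

definition integrable_acs :: "'a chart set \<Rightarrow> 'a coefficients \<Rightarrow> bool" where
  "integrable_acs A J \<longleftrightarrow>
     (\<forall>c\<in>A. \<forall>x\<in>coords c. \<forall>i j. nijenhuis (J c) (\<lambda>_. axis i 1) (\<lambda>_. axis j 1) x = 0)"

definition orthogonal_acs :: "'a chart set \<Rightarrow> 'a coefficients \<Rightarrow> 'a coefficients \<Rightarrow> bool" where
  "orthogonal_acs A g J \<longleftrightarrow>
     (\<forall>c\<in>A. \<forall>x\<in>coords c. \<forall>u v. form (g c x) (J c x *v u) (J c x *v v) = form (g c x) u v)"

text \<open>The coefficients of \<open>\<omega>\<^sub>J = g(J\<cdot>,\<cdot>)\<close>.\<close>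

definition fundamental_form :: "'a coefficients \<Rightarrow> 'a coefficients \<Rightarrow> 'a coefficients" where
  "fundamental_form g J c x = (\<chi> i j. form (g c x) (J c x *v axis i 1) (axis j 1))"

definition closed_form2 :: "'a chart set \<Rightarrow> 'a coefficients \<Rightarrow> bool" where
  "closed_form2 A w \<longleftrightarrow> (\<forall>c\<in>A. \<forall>x\<in>coords c. \<forall>i j k. ext_deriv2 (w c) i j k x = 0)"

definition orthogonal_almost_kaehler :: "'a chart set \<Rightarrow> 'a coefficients \<Rightarrow> 'a coefficients \<Rightarrow> bool" where
  "orthogonal_almost_kaehler A g J \<longleftrightarrow>
     almost_complex A J \<and> orthogonal_acs A g J \<and> closed_form2 A (fundamental_form g J)"

definition kaehler :: "'a chart set \<Rightarrow> 'a coefficients \<Rightarrow> 'a coefficients \<Rightarrow> bool" where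
  "kaehler A g J \<longleftrightarrow> riemannian_metric A g \<and> orthogonal_almost_kaehler A g J \<and> integrable_acs A J"

definition kaehler_einstein_surface ::
  "'a topology \<Rightarrow> 'a chart set \<Rightarrow> 'a coefficients \<Rightarrow> 'a coefficients \<Rightarrow> bool" where
  "kaehler_einstein_surface M A g J \<longleftrightarrow>
     smooth_four_manifold M A \<and> kaehler A g J \<and> einstein A g"

end

theory Submission
  imports Defs
begin

text \<open>The argument is local. Both structures being orthogonal and positive,
  \<open>J J' + J' J = - 2 f\<close> for a function \<open>f\<close> with values in \<open>[-1, 1]\<close>, and \<open>J' = f J\<close> where
  \<open>f\<^sup>2 = 1\<close>. On the open set where \<open>f\<^sup>2 < 1\<close> put \<open>n = grad (artanh f)\<close>, \<open>H = \<nabla> n\<close>,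
  \<open>M = J - f J'\<close> and \<open>L = J J' + f\<close>. As \<open>J\<close> is parallel, closedness of \<open>\<omega>\<^sub>J\<^sub>'\<close> forces
  \<open>\<nabla>\<^sub>X J' = g(n, X) M + g(J' n, X) L\<close>. Commuting covariant derivatives of \<open>J'\<close> and
  using that the Ricci form is \<open>k \<omega>\<^sub>J\<close>, where \<open>Ric = k g\<close>, gives
  \<open>J' H + H J' + g(n, n) M = - k J\<close>, and taking traces against \<open>J\<close> and \<open>J'\<close> yields
  \<open>g(n, n) = - k\<close> and \<open>tr H = - 2 k f\<close>. Since \<open>n\<close> has constant length, Bochner's formula
  becomes \<open>tr H\<^sup>2 = k\<^sup>2 (2 f\<^sup>2 - 1)\<close>, whereas \<open>tr H\<^sup>2 \<ge> (tr H)\<^sup>2 / 4 = k\<^sup>2 f\<^sup>2\<close>. As \<open>f\<^sup>2 < 1\<close> this forces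
  \<open>k = 0\<close>, hence \<open>n = 0\<close> and \<open>\<nabla> J' = 0\<close>. So \<open>\<nabla> J' = 0\<close> everywhere, and if \<open>k \<noteq> 0\<close> then
  \<open>J' = \<plusminus>J\<close> with a sign that is constant by connectedness.\<close>


section \<open>Directional derivatives and smooth functions\<close>

text \<open>The manifold need not be compact, so integral formulas are not at hand and the
  contradiction has to come from a single point. The identity \<open>g(n, n) = - k\<close> alone
  excludes only \<open>k > 0\<close>. For \<open>k < 0\<close> it is the constancy of the length of
  \<open>n\<close> that turns Bochner's formula into an algebraic equation for \<open>H\<close>. The
  function \<open>artanh f\<close> comes from a normalization. A skew endomorphism that anticommutes
  with \<open>J'\<close> and whose anticommutator with \<open>J\<close> is scalar is a combination
  of \<open>M\<close> and \<open>L\<close>. Differentiating \<open>J J' + J' J = - 2 f\<close> shows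
  that \<open>\<nabla> J'\<close> is of this kind and that its coefficient along \<open>M\<close> is
  \<open>df / (1 - f^2)\<close>, the differential of \<open>artanh f\<close>. The set where
  \<open>f^2 = 1\<close> is closed and may have an irregular boundary, so \<open>J' = f J\<close>
  cannot simply be differentiated at its points. The argument there uses the set where
  \<open>\<nabla> J' \<noteq> 0\<close> instead, which is open.\<close>

definition dd :: "'a::euclidean_space \<Rightarrow> ('a \<Rightarrow> 'b::real_normed_vector) \<Rightarrow> 'a \<Rightarrow> 'b" where
  "dd v f x = frechet_derivative f (at x) v"

lemma has_derivative_dd:
  "f differentiable (at x) \<Longrightarrow> (f has_derivative (\<lambda>v. dd v f x)) (at x)"
  unfolding dd_def using frechet_derivative_works by (metis eta_contract_eq)

lemma dd_eqI: "(f has_derivative f') (at x) \<Longrightarrow> dd v f x = f' v"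
  unfolding dd_def by (metis frechet_derivative_at)

lemma linear_dd: "f differentiable (at x) \<Longrightarrow> linear (\<lambda>v. dd v f x)"
  unfolding dd_def using linear_frechet_derivative by (metis eta_contract_eq)

lemma partial_eq_dd: "partial i f x = dd (axis i 1) f x"
  by (simp add: partial_def dd_def)

lemma dd_cong:
  assumes "open S" "x \<in> S" "\<And>y. y \<in> S \<Longrightarrow> f y = g y"
  shows "dd v f x = dd v g x"
proof -
  \<comment> \<open>Differentiability is not assumed: \<open>frechet_derivative\<close> is a choice
    among the derivatives at \<open>x\<close>, so it suffices that \<open>f\<close> and
    \<open>g\<close> have the same ones, possibly none.\<close>
  have "(f has_derivative f') (at x) \<longleftrightarrow> (g has_derivative f') (at x)" for f'
    using assms has_derivative_transform_within_open[of f f' x UNIV S g]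
      has_derivative_transform_within_open[of g f' x UNIV S f] by auto
  then show ?thesis unfolding dd_def frechet_derivative_def by simp
qed

lemma differentiable_cong_open:
  assumes "open S" "x \<in> S" "\<And>y. y \<in> S \<Longrightarrow> f y = g y"
  shows "f differentiable (at x) \<longleftrightarrow> g differentiable (at x)"
  unfolding differentiable_def
  using assms has_derivative_transform_within_open[of f _ x UNIV S g]
    has_derivative_transform_within_open[of g _ x UNIV S f] by (metis)

lemma dd_const [simp]: "dd v (\<lambda>x. c) x = 0"
  by (rule dd_eqI) (auto intro!: derivative_eq_intros)

lemma dd_add:
  "f differentiable (at x) \<Longrightarrow> g differentiable (at x) \<Longrightarrow> dd v (\<lambda>x. f x + g x) x = dd v f x + dd v g x"
  by (rule dd_eqI) (intro has_derivative_add has_derivative_dd)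

lemma dd_diff:
  "f differentiable (at x) \<Longrightarrow> g differentiable (at x) \<Longrightarrow> dd v (\<lambda>x. f x - g x) x = dd v f x - dd v g x"
  by (rule dd_eqI) (intro has_derivative_diff has_derivative_dd)

lemma dd_linear:
  assumes "bounded_linear h" "f differentiable (at x)"
  shows "dd v (\<lambda>x. h (f x)) x = h (dd v f x)"
  by (rule dd_eqI) (rule bounded_linear.has_derivative[OF assms(1) has_derivative_dd[OF assms(2)]])

lemma dd_bilinear:
  assumes "bounded_bilinear B" "f differentiable (at x)" "g differentiable (at x)"
  shows "dd v (\<lambda>x. B (f x) (g x)) x = B (f x) (dd v g x) + B (dd v f x) (g x)"
  by (rule dd_eqI)
     (rule bounded_bilinear.FDERIV[OF assms(1) has_derivative_dd[OF assms(2)] has_derivative_dd[OF assms(3)]])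

lemma differentiable_linear:
  "bounded_linear h \<Longrightarrow> f differentiable (at x) \<Longrightarrow> (\<lambda>x. h (f x)) differentiable (at x)"
  unfolding differentiable_def using bounded_linear.has_derivative by blast

lemma differentiable_bilinear:
  "bounded_bilinear B \<Longrightarrow> f differentiable (at x) \<Longrightarrow> g differentiable (at x) \<Longrightarrow>
    (\<lambda>x. B (f x) (g x)) differentiable (at x)"
  unfolding differentiable_def using bounded_bilinear.FDERIV by blast

lemma Ck_on_Suc:
  "Ck_on (Suc k) f S \<longleftrightarrow> (\<forall>x\<in>S. f differentiable (at x)) \<and> (\<forall>v. Ck_on k (dd v f) S)"
  by (simp add: dd_def[abs_def])

lemma Ck_on_differentiable: "Ck_on (Suc k) f S \<Longrightarrow> x \<in> S \<Longrightarrow> f differentiable (at x)"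
  by simp

lemma Ck_on_dd: "Ck_on (Suc k) f S \<Longrightarrow> Ck_on k (dd v f) S"
  using Ck_on_Suc by blast

declare Ck_on.simps(2) [simp del]

lemma Ck_on_cong:
  assumes "open S" "\<And>x. x \<in> S \<Longrightarrow> f x = g x"
  shows "Ck_on k f S \<longleftrightarrow> Ck_on k g S"
  using assms(2)
proof (induction k arbitrary: f g)
  case 0
  then show ?case using continuous_on_cong by auto
next
  case (Suc k)
  have "Ck_on k (dd v f) S \<longleftrightarrow> Ck_on k (dd v g) S" for v
    by (rule Suc.IH) (metis Suc.prems dd_cong[OF assms(1)])
  then show ?case
    unfolding Ck_on_Suc using differentiable_cong_open[OF assms(1), of _ f g] Suc.prems by auto
qed

lemma Ck_on_pred: "Ck_on (Suc k) f S \<Longrightarrow> Ck_on k f S"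
proof (induction k arbitrary: f)
  case 0
  then show ?case
    by (auto simp: Ck_on_Suc intro!: continuous_at_imp_continuous_on differentiable_imp_continuous_within)
next
  case (Suc k)
  then show ?case using Ck_on_Suc by blast
qed

lemma Ck_on_const: "Ck_on k (\<lambda>x. c) S"
proof (induction k arbitrary: c)
  case (Suc k)
  have "dd v (\<lambda>x. c) = (\<lambda>x. 0)" for v :: 'a by (rule ext) simp
  then show ?case using Suc by (simp add: Ck_on_Suc)
qed simp

lemma Ck_on_add:
  assumes "open S"
  shows "Ck_on k f S \<Longrightarrow> Ck_on k g S \<Longrightarrow> Ck_on k (\<lambda>x. f x + g x) S"
proof (induction k arbitrary: f g)
  case 0
  then show ?case by (simp add: continuous_on_add)
next
  case (Suc k)
  have "Ck_on k (dd v (\<lambda>x. f x + g x)) S" for v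
    by (rule Ck_on_cong[OF assms, THEN iffD1, OF _ Suc.IH[OF Ck_on_dd[OF Suc.prems(1), of v] Ck_on_dd[OF Suc.prems(2), of v]]])
      (rule dd_add[symmetric]; use Suc.prems Ck_on_differentiable in blast)
  then show ?case using Suc.prems by (auto simp: Ck_on_Suc)
qed

lemma Ck_on_linear:
  assumes "open S" "bounded_linear h"
  shows "Ck_on k f S \<Longrightarrow> Ck_on k (\<lambda>x. h (f x)) S"
proof (induction k arbitrary: f)
  case 0
  then show ?case using assms by (simp add: bounded_linear.continuous_on)
next
  case (Suc k)
  have "Ck_on k (dd v (\<lambda>x. h (f x))) S" for v
    by (rule Ck_on_cong[OF assms(1), THEN iffD1, OF _ Suc.IH[OF Ck_on_dd[OF Suc.prems(1), of v]]])
      (rule dd_linear[OF assms(2), symmetric]; use Suc.prems Ck_on_differentiable in blast)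
  then show ?case using Suc.prems assms by (auto simp: Ck_on_Suc intro: differentiable_linear)
qed

lemma Ck_on_bilinear:
  assumes "open S" "bounded_bilinear B"
  shows "Ck_on k f S \<Longrightarrow> Ck_on k g S \<Longrightarrow> Ck_on k (\<lambda>x. B (f x) (g x)) S"
proof (induction k arbitrary: f g)
  case 0
  then show ?case using assms by (simp add: bounded_bilinear.continuous_on)
next
  case (Suc k)
  have "Ck_on k (dd v (\<lambda>x. B (f x) (g x))) S" for v
    by (rule Ck_on_cong[OF assms(1), THEN iffD1,
          OF _ Ck_on_add[OF assms(1) Suc.IH[OF Ck_on_pred[OF Suc.prems(1)] Ck_on_dd[OF Suc.prems(2), of v]]
            Suc.IH[OF Ck_on_dd[OF Suc.prems(1), of v] Ck_on_pred[OF Suc.prems(2)]]]])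
      (rule dd_bilinear[OF assms(2), symmetric]; use Suc.prems Ck_on_differentiable in blast)
  then show ?case using Suc.prems assms by (auto simp: Ck_on_Suc intro: differentiable_bilinear)
qed

lemma Ck_on_inverse:
  fixes f :: "'a::euclidean_space \<Rightarrow> real"
  assumes "open S" and nz: "\<And>x. x \<in> S \<Longrightarrow> f x \<noteq> 0"
  shows "Ck_on k f S \<Longrightarrow> Ck_on k (\<lambda>x. inverse (f x)) S"
proof (induction k)
  case 0
  then show ?case using nz by (auto intro: continuous_on_inverse)
next
  case (Suc k)
  have hd: "((\<lambda>x. inverse (f x)) has_derivative (\<lambda>v. - (inverse (f x) * dd v f x * inverse (f x)))) (at x)"
    if "x \<in> S" for x
    using Deriv.has_derivative_inverse[OF nz[OF that] has_derivative_dd[OF Ck_on_differentiable[OF Suc.prems that]]] .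
  \<comment> \<open>The derivative contains \<open>1/f\<close> again, but only to the order
    \<open>k\<close> that the induction hypothesis provides.\<close>
  have *: "Ck_on k (\<lambda>x. inverse (f x)) S" using Suc Ck_on_pred by blast
  have "Ck_on k (\<lambda>x. - (inverse (f x) * dd v f x * inverse (f x))) S" for v
    by (intro Ck_on_linear[OF assms(1) bounded_linear_minus[OF bounded_linear_ident]]
        Ck_on_bilinear[OF assms(1) bounded_bilinear_mult] * Ck_on_dd[OF Suc.prems])
  then have "Ck_on k (dd v (\<lambda>x. inverse (f x))) S" for v
    by (rule Ck_on_cong[OF assms(1), THEN iffD1, rotated]) (rule dd_eqI[OF hd, symmetric])
  then show ?case unfolding Ck_on_Suc differentiable_def using hd by blast
qed

section \<open>Closure properties of smooth functions\<close>

lemma smooth_on_differentiable: "smooth_on f S \<Longrightarrow> x \<in> S \<Longrightarrow> f differentiable (at x)"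
  unfolding smooth_on_def using Ck_on_differentiable by blast

lemma smooth_on_continuous: "smooth_on f S \<Longrightarrow> continuous_on S f"
  unfolding smooth_on_def using Ck_on.simps(1) by blast

lemma smooth_on_dd: "smooth_on f S \<Longrightarrow> smooth_on (dd v f) S"
  unfolding smooth_on_def using Ck_on_dd by blast

lemma smooth_on_cong:
  "open S \<Longrightarrow> (\<And>x. x \<in> S \<Longrightarrow> f x = g x) \<Longrightarrow> smooth_on f S \<longleftrightarrow> smooth_on g S"
  unfolding smooth_on_def using Ck_on_cong by blast

lemma Ck_on_subset: "Ck_on k f S \<Longrightarrow> T \<subseteq> S \<Longrightarrow> Ck_on k f T"
  by (induction k arbitrary: f) (auto simp: Ck_on_Suc intro: continuous_on_subset)

lemma smooth_on_subset: "smooth_on f S \<Longrightarrow> T \<subseteq> S \<Longrightarrow> smooth_on f T"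
  unfolding smooth_on_def using Ck_on_subset by blast

lemma smooth_on_const [simp]: "smooth_on (\<lambda>x. c) S"
  unfolding smooth_on_def using Ck_on_const by blast

lemma smooth_on_linear: "open S \<Longrightarrow> bounded_linear h \<Longrightarrow> smooth_on f S \<Longrightarrow> smooth_on (\<lambda>x. h (f x)) S"
  unfolding smooth_on_def using Ck_on_linear by blast

lemma smooth_on_add: "open S \<Longrightarrow> smooth_on f S \<Longrightarrow> smooth_on g S \<Longrightarrow> smooth_on (\<lambda>x. f x + g x) S"
  unfolding smooth_on_def using Ck_on_add by blast

lemma smooth_on_minus: "open S \<Longrightarrow> smooth_on f S \<Longrightarrow> smooth_on (\<lambda>x. - f x) S"
  by (rule smooth_on_linear[OF _ bounded_linear_minus[OF bounded_linear_ident]])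

lemma smooth_on_diff: "open S \<Longrightarrow> smooth_on f S \<Longrightarrow> smooth_on g S \<Longrightarrow> smooth_on (\<lambda>x. f x - g x) S"
  using smooth_on_add[OF _ _ smooth_on_minus] by force

lemma smooth_on_sum:
  "open S \<Longrightarrow> (\<And>i. i \<in> I \<Longrightarrow> smooth_on (f i) S) \<Longrightarrow> smooth_on (\<lambda>x. \<Sum>i\<in>I. f i x) S"
  by (induction I rule: infinite_finite_induct) (auto intro: smooth_on_add)

lemma smooth_on_bilinear:
  "open S \<Longrightarrow> bounded_bilinear B \<Longrightarrow> smooth_on f S \<Longrightarrow> smooth_on g S \<Longrightarrow> smooth_on (\<lambda>x. B (f x) (g x)) S"
  unfolding smooth_on_def using Ck_on_bilinear by blast

lemmas smooth_on_mult = smooth_on_bilinear[OF _ bounded_bilinear_mult]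
lemmas smooth_on_scaleR = smooth_on_bilinear[OF _ bounded_bilinear_scaleR]

lemma smooth_on_inverse:
  fixes f :: "'a::euclidean_space \<Rightarrow> real"
  shows "open S \<Longrightarrow> (\<And>x. x \<in> S \<Longrightarrow> f x \<noteq> 0) \<Longrightarrow> smooth_on f S \<Longrightarrow> smooth_on (\<lambda>x. inverse (f x)) S"
  unfolding smooth_on_def using Ck_on_inverse by blast

lemma smooth_on_prod:
  fixes f :: "'i \<Rightarrow> 'a::euclidean_space \<Rightarrow> real"
  shows "open S \<Longrightarrow> (\<And>i. i \<in> I \<Longrightarrow> smooth_on (f i) S) \<Longrightarrow> smooth_on (\<lambda>x. \<Prod>i\<in>I. f i x) S"
  by (induction I rule: infinite_finite_induct) (auto intro: smooth_on_mult)

lemma smooth_on_vec_nth: "open S \<Longrightarrow> smooth_on f S \<Longrightarrow> smooth_on (\<lambda>x. f x $ i) S"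
  by (rule smooth_on_linear[OF _ bounded_linear_vec_nth])

lemma bounded_linear_axis: "bounded_linear (axis i :: 'b::real_normed_vector \<Rightarrow> 'b^'n)"
  by (rule bounded_linear_intro[where K=1])
    (auto simp: axis_def vec_eq_iff norm_axis_1 norm_vec_def L2_set_def
      power2_eq_square if_distrib[of norm] if_distrib[of "\<lambda>u. u * _"] sum.delta cong: if_cong)

lemma smooth_on_vec:
  fixes f :: "'a::euclidean_space \<Rightarrow> ('b::real_normed_vector)^'n"
  assumes "open S" "\<And>i. smooth_on (\<lambda>x. f x $ i) S"
  shows "smooth_on f S"
proof -
  have "f = (\<lambda>x. \<Sum>i\<in>UNIV. axis i (f x $ i))"
    by (rule ext) (simp add: vec_eq_iff axis_def sum.delta cong: if_cong)
  moreover have "smooth_on (\<lambda>x. \<Sum>i\<in>UNIV. axis i (f x $ i)) S"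
    by (intro smooth_on_sum assms smooth_on_linear[OF _ bounded_linear_axis])
  ultimately show ?thesis by simp
qed

lemma matrix_inv_inverse:
  fixes A :: "real^'n^'n"
  assumes "invertible A"
  shows "A ** matrix_inv A = mat 1" "matrix_inv A ** A = mat 1"
  using assms someI_ex[of "\<lambda>B. A ** B = mat 1 \<and> B ** A = mat 1"]
  unfolding invertible_def matrix_inv_def by auto

lemma smooth_on_det:
  fixes F :: "'a::euclidean_space \<Rightarrow> real^'n^'n"
  assumes "open S" "\<And>i j. smooth_on (\<lambda>x. F x $ i $ j) S"
  shows "smooth_on (\<lambda>x. det (F x)) S"
  unfolding det_def by (intro smooth_on_sum smooth_on_mult smooth_on_prod assms smooth_on_const)

text \<open>Cramer's rule makes each entry of the inverse a quotient of determinants, and these are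
  polynomials in the entries of \<open>F\<close> and constants.\<close>

lemma smooth_on_matrix_inv:
  fixes F :: "'a::euclidean_space \<Rightarrow> real^'n^'n"
  assumes S: "open S" and F: "smooth_on F S" and inv: "\<And>x. x \<in> S \<Longrightarrow> invertible (F x)"
  shows "smooth_on (\<lambda>x. matrix_inv (F x)) S"
proof (intro smooth_on_vec[OF S])
  fix i j
  have nz: "det (F x) \<noteq> 0" if "x \<in> S" for x
    using inv[OF that] invertible_det_nz by blast
  have F': "smooth_on (\<lambda>x. F x $ k $ l) S" for k l
    using smooth_on_vec_nth[OF S smooth_on_vec_nth[OF S F, of k], of l] .
  let ?h = "\<lambda>x. det (\<chi> k l. if l = i then axis j 1 $ k else F x $ k $ l) * inverse (det (F x))"
  have "matrix_inv (F x) $ i $ j = ?h x" if "x \<in> S" for x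
  proof -
    have "F x *v (matrix_inv (F x) *v axis j 1) = axis j 1"
      using inv[OF that] by (metis matrix_inv_inverse(1) matrix_vector_mul_assoc matrix_vector_mul_lid)
    then have "matrix_inv (F x) *v axis j 1 =
        (\<chi> k. det (\<chi> i l. if l = k then axis j 1 $ i else F x $ i $ l) / det (F x))"
      using cramer[OF nz[OF that]] by blast
    then have "(matrix_inv (F x) *v axis j 1) $ i = ?h x"
      by (simp add: divide_inverse)
    then show ?thesis by (simp add: matrix_vector_mul_component inner_axis)
  qed
  moreover have "smooth_on ?h S"
  proof (intro smooth_on_mult S smooth_on_inverse smooth_on_det F' nz)
    fix k l show "smooth_on (\<lambda>x. (\<chi> k l. if l = i then axis j (1::real) $ k else F x $ k $ l) $ k $ l) S"
      using F' by (cases "l = i") auto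
  qed
  ultimately show "smooth_on (\<lambda>x. matrix_inv (F x) $ i $ j) S"
    by (subst smooth_on_cong[OF S, where g="?h"]) auto
qed

text \<open>Symmetry of the second derivative: the second difference of \<open>f\<close> over a parallelogram is,
  by the mean value theorem applied in either order, a value of either mixed derivative nearby.\<close>

lemma second_difference_mvt:
  fixes f :: "'a::euclidean_space \<Rightarrow> real"
  assumes f: "smooth_on f S" and s: "s > 0"
    and sub: "\<And>a b. 0 \<le> a \<Longrightarrow> a \<le> s \<Longrightarrow> 0 \<le> b \<Longrightarrow> b \<le> s \<Longrightarrow> x + a *\<^sub>R v + b *\<^sub>R w \<in> S"
  shows "\<exists>a b. 0 \<le> a \<and> a \<le> s \<and> 0 \<le> b \<and> b \<le> s \<and>
    f (x + s *\<^sub>R v + s *\<^sub>R w) - f (x + s *\<^sub>R v) - f (x + s *\<^sub>R w) + f x =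
      s * s * dd w (dd v f) (x + a *\<^sub>R v + b *\<^sub>R w)"
proof -
  have line: "((\<lambda>t. h (p + t *\<^sub>R u)) has_real_derivative dd u h (p + t *\<^sub>R u)) (at t)"
    if "h differentiable (at (p + t *\<^sub>R u))" for h :: "'a \<Rightarrow> real" and p u t
  proof -
    have "((\<lambda>t. p + t *\<^sub>R u) has_derivative (\<lambda>r. r *\<^sub>R u)) (at t)"
      by (auto intro!: derivative_eq_intros)
    from has_derivative_compose[OF this has_derivative_dd[OF that]]
    have "((\<lambda>t. h (p + t *\<^sub>R u)) has_derivative (\<lambda>r. dd (r *\<^sub>R u) h (p + t *\<^sub>R u))) (at t)" .
    moreover have "dd (r *\<^sub>R u) h (p + t *\<^sub>R u) = dd u h (p + t *\<^sub>R u) * r" for r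
      using linear_cmul[OF linear_dd[OF that], of r u] by simp
    ultimately show ?thesis by (simp add: has_field_derivative_def)
  qed
  define \<phi> where "\<phi> t = f (x + t *\<^sub>R v + s *\<^sub>R w) - f (x + t *\<^sub>R v)" for t
  have d\<phi>: "(\<phi> has_real_derivative (dd v f (x + t *\<^sub>R v + s *\<^sub>R w) - dd v f (x + t *\<^sub>R v))) (at t)"
    if "0 \<le> t" "t \<le> s" for t
  proof -
    have 1: "f differentiable (at (x + s *\<^sub>R w + t *\<^sub>R v))" "f differentiable (at (x + t *\<^sub>R v))"
      using sub[OF that, of s] sub[OF that, of 0] s smooth_on_differentiable[OF f] by (auto simp: algebra_simps)
    show ?thesis unfolding \<phi>_def
      using DERIV_diff[OF line[OF 1(1)] line[OF 1(2)]] by (simp add: algebra_simps)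
  qed
  obtain a where a: "0 < a" "a < s"
    "\<phi> s - \<phi> 0 = (s - 0) * (dd v f (x + a *\<^sub>R v + s *\<^sub>R w) - dd v f (x + a *\<^sub>R v))"
    using MVT2[OF s, of \<phi>, OF d\<phi>] by blast
  have d\<psi>: "((\<lambda>t. dd v f (x + a *\<^sub>R v + t *\<^sub>R w)) has_real_derivative
      dd w (dd v f) (x + a *\<^sub>R v + t *\<^sub>R w)) (at t)" if "0 \<le> t" "t \<le> s" for t
    by (rule line) (rule smooth_on_differentiable[OF smooth_on_dd[OF f]], use sub a that in auto)
  obtain b where b: "0 < b" "b < s"
    "dd v f (x + a *\<^sub>R v + s *\<^sub>R w) - dd v f (x + a *\<^sub>R v + 0 *\<^sub>R w) =
      (s - 0) * dd w (dd v f) (x + a *\<^sub>R v + b *\<^sub>R w)"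
    using MVT2[OF s, of "\<lambda>t. dd v f (x + a *\<^sub>R v + t *\<^sub>R w)", OF d\<psi>] by blast
  show ?thesis
    using a b by (intro exI[of _ a] exI[of _ b]) (auto simp: \<phi>_def)
qed

lemma dd_commute_real:
  fixes f :: "'a::euclidean_space \<Rightarrow> real"
  assumes S: "open S" and f: "smooth_on f S" and x: "x \<in> S"
  shows "dd v (dd w f) x = dd w (dd v f) x"
proof (rule ccontr)
  assume ne: "\<not> ?thesis"
  \<comment> \<open>Half the gap: a common value cannot lie closer than \<open>e\<close> to both
    mixed derivatives at \<open>x\<close>.\<close>
  define e where "e = \<bar>dd v (dd w f) x - dd w (dd v f) x\<bar> / 2"
  have e: "e > 0" using ne by (simp add: e_def)
  have near: "\<forall>\<^sub>F y in at x. dist (dd p (dd q f) y) (dd p (dd q f) x) < e" for p q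
    using smooth_on_continuous[OF smooth_on_dd[OF smooth_on_dd[OF f, of q], of p]] S x e
    by (metis at_within_open continuous_on_def tendstoD)
  from near[of v w] near[of w v]
  have "\<forall>\<^sub>F y in nhds x. dist (dd v (dd w f) y) (dd v (dd w f) x) < e \<and>
      dist (dd w (dd v f) y) (dd w (dd v f) x) < e \<and> y \<in> S"
    using eventually_nhds_in_open[OF S x]
    unfolding eventually_at_filter by eventually_elim (use e in force)
  then obtain d where d: "d > 0" and dS: "\<And>y. dist y x < d \<Longrightarrow> dist (dd v (dd w f) y) (dd v (dd w f) x) < e \<and>
      dist (dd w (dd v f) y) (dd w (dd v f) x) < e \<and> y \<in> S"
    by (auto simp: eventually_nhds_metric)
  \<comment> \<open>So small that the parallelogram with sides \<open>s v\<close> and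
    \<open>s w\<close> stays within distance \<open>d\<close> of \<open>x\<close>; the summand 1
    keeps the denominator positive.\<close>
  define s where "s = d / (2 * (norm v + norm w + 1))"
  have n: "norm v + norm w + 1 > 0" by (smt (verit) norm_ge_zero)
  have s: "s > 0" using d n by (simp add: s_def)
  have sd: "s * (norm v + norm w) < d"
  proof -
    have "s * (norm v + norm w) \<le> s * (norm v + norm w + 1)" using s by (simp add: algebra_simps)
    also have "\<dots> = d / 2" using n by (simp add: s_def divide_simps)
    finally show ?thesis using d by simp
  qed
  have cl: "dist (x + a *\<^sub>R v + b *\<^sub>R w) x < d" if "0 \<le> a" "a \<le> s" "0 \<le> b" "b \<le> s" for a b
  proof -
    have "dist (x + a *\<^sub>R v + b *\<^sub>R w) x = norm (a *\<^sub>R v + b *\<^sub>R w)" by (simp add: dist_norm)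
    also have "\<dots> \<le> a * norm v + b * norm w" using norm_triangle_ineq[of "a *\<^sub>R v" "b *\<^sub>R w"] that by simp
    also have "\<dots> \<le> s * norm v + s * norm w" using that by (intro add_mono mult_right_mono) auto
    finally show ?thesis using sd by (simp add: algebra_simps)
  qed
  have subS: "x + a *\<^sub>R v + b *\<^sub>R w \<in> S" "x + a *\<^sub>R w + b *\<^sub>R v \<in> S"
    if "0 \<le> a" "a \<le> s" "0 \<le> b" "b \<le> s" for a b
    using cl[OF that] cl[OF that(3,4,1,2)] dS by (auto simp: algebra_simps)
  obtain a b where ab: "0 \<le> a" "a \<le> s" "0 \<le> b" "b \<le> s"
    "f (x + s *\<^sub>R v + s *\<^sub>R w) - f (x + s *\<^sub>R v) - f (x + s *\<^sub>R w) + f x =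
      s * s * dd w (dd v f) (x + a *\<^sub>R v + b *\<^sub>R w)"
    using second_difference_mvt[OF f s subS(1)] by blast
  obtain a' b' where ab': "0 \<le> a'" "a' \<le> s" "0 \<le> b'" "b' \<le> s"
    "f (x + s *\<^sub>R w + s *\<^sub>R v) - f (x + s *\<^sub>R w) - f (x + s *\<^sub>R v) + f x =
      s * s * dd v (dd w f) (x + a' *\<^sub>R w + b' *\<^sub>R v)"
    using second_difference_mvt[OF f s subS(2)] by blast
  have "s * s * dd w (dd v f) (x + a *\<^sub>R v + b *\<^sub>R w) = s * s * dd v (dd w f) (x + a' *\<^sub>R w + b' *\<^sub>R v)"
    using ab(5) ab'(5) by (simp add: algebra_simps)
  then have "dd w (dd v f) (x + a *\<^sub>R v + b *\<^sub>R w) = dd v (dd w f) (x + b' *\<^sub>R v + a' *\<^sub>R w)"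
    using s by (simp add: algebra_simps)
  moreover have "dist (dd w (dd v f) (x + a *\<^sub>R v + b *\<^sub>R w)) (dd w (dd v f) x) < e"
    using cl[OF ab(1-4)] dS by blast
  moreover have "dist (dd v (dd w f) (x + b' *\<^sub>R v + a' *\<^sub>R w)) (dd v (dd w f) x) < e"
    using cl[OF ab'(3,4,1,2)] dS by blast
  ultimately show False unfolding e_def dist_real_def by (smt (verit) field_sum_of_halves)
qed

lemma dd_commute:
  fixes f :: "'a::euclidean_space \<Rightarrow> 'b::euclidean_space"
  assumes S: "open S" and f: "smooth_on f S" and x: "x \<in> S"
  shows "dd v (dd w f) x = dd w (dd v f) x"
proof (rule euclidean_eqI)
  fix b :: 'b
  have bl: "bounded_linear (\<lambda>y. y \<bullet> b)" by (rule bounded_linear_inner_left)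
  have *: "dd p (dd q f) x \<bullet> b = dd p (dd q (\<lambda>y. f y \<bullet> b)) x" for p q
  proof -
    have "dd p (dd q (\<lambda>y. f y \<bullet> b)) x = dd p (\<lambda>y. dd q f y \<bullet> b) x"
      by (rule dd_cong[OF S x]) (rule dd_linear[OF bl smooth_on_differentiable[OF f]])
    also have "\<dots> = dd p (dd q f) x \<bullet> b"
      by (rule dd_linear[OF bl smooth_on_differentiable[OF smooth_on_dd[OF f] x]])
    finally show ?thesis by simp
  qed
  show "dd v (dd w f) x \<bullet> b = dd w (dd v f) x \<bullet> b"
    unfolding * by (rule dd_commute_real[OF S smooth_on_linear[OF S bl f] x])
qed


section \<open>Orthogonal complex structures on a four-dimensional Euclidean space\<close>

lemma matrix_vector_mult_uminus_left: "(- A) *v x = - (A *v x)" for A :: "real^'n^'m"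
  using scaleR_matrix_vector_assoc[of "-1" A x] by simp

lemma matrix_vector_mult_uminus_right: "A *v (- x) = - (A *v x)" for A :: "real^'n^'m"
  using matrix_vector_mult_scaleR[of A "-1" x] by simp

lemmas mv_simps = matrix_vector_right_distrib matrix_vector_mult_diff_distrib matrix_vector_mult_scaleR
  matrix_vector_mult_add_rdistrib matrix_vector_mult_diff_rdistrib
  scaleR_matrix_vector_assoc[symmetric] matrix_vector_mul_assoc[symmetric]
  matrix_vector_mult_uminus_left matrix_vector_mult_uminus_right

lemma form_add_left: "form B (u + u') v = form B u v + form B u' v"
  and form_add_right: "form B u (v + v') = form B u v + form B u v'"
  and form_diff_left: "form B (u - u') v = form B u v - form B u' v"
  and form_diff_right: "form B u (v - v') = form B u v - form B u v'"
  and form_scaleR_left: "form B (c *\<^sub>R u) v = c * form B u v"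
  and form_scaleR_right: "form B u (c *\<^sub>R v) = c * form B u v"
  and form_minus_left: "form B (- u) v = - form B u v"
  and form_minus_right: "form B u (- v) = - form B u v"
  and form_0_left: "form B 0 v = 0"
  and form_0_right: "form B u 0 = 0"
  by (simp_all add: form_def mv_simps inner_simps)

lemmas form_simps = form_add_left form_add_right form_diff_left form_diff_right form_scaleR_left
  form_scaleR_right form_minus_left form_minus_right form_0_left form_0_right

lemma form_axis: "form B (axis i 1) (axis j 1) = B $ i $ j"
  by (simp add: form_def matrix_vector_mul_component inner_axis inner_axis')

lemma span_four:
  fixes a b c d :: "real^4"
  assumes "\<And>p q r s. p *\<^sub>R a + q *\<^sub>R b + r *\<^sub>R c + s *\<^sub>R d = 0 \<Longrightarrow> p = 0 \<and> q = 0 \<and> r = 0 \<and> s = 0"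
  obtains p q r s where "w = p *\<^sub>R a + q *\<^sub>R b + r *\<^sub>R c + s *\<^sub>R d"
proof -
  define T where "T x = x $ 1 *\<^sub>R a + x $ 2 *\<^sub>R b + x $ 3 *\<^sub>R c + x $ 4 *\<^sub>R d" for x :: "real^4"
  have lin: "linear T" by (rule linearI) (auto simp: T_def algebra_simps)
  have "inj T"
    unfolding linear_injective_0[OF lin]
  proof (intro allI impI)
    fix x assume "T x = 0"
    then have "x $ 1 = 0 \<and> x $ 2 = 0 \<and> x $ 3 = 0 \<and> x $ 4 = 0" unfolding T_def by (rule assms)
    then show "x = 0" by (simp add: vec_eq_iff forall_4)
  qed
  then have "surj T" using linear_injective_imp_surjective[OF lin] by blast
  then show ?thesis using that unfolding T_def surj_def by metis
qed

locale pos_def =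
  fixes G :: "real^'n^'n"
  assumes sym: "form G u v = form G v u"
    and pos: "v \<noteq> 0 \<Longrightarrow> form G v v > 0"
begin

lemma form_self_eq_0: "form G v v = 0 \<longleftrightarrow> v = 0"
  using pos[of v] by (cases "v = 0") (auto simp: form_simps)

lemma form_self_nonneg: "form G v v \<ge> 0"
  using pos[of v] by (cases "v = 0") (auto simp: form_simps)

lemma form_eqI: "(\<And>w. form G u w = form G v w) \<Longrightarrow> u = v"
  using form_self_eq_0[of "u - v"] by (simp add: form_simps)

lemma invertible_form: "invertible G"
proof -
  have "v = 0" if "G *v v = 0" for v
    using that form_self_eq_0[of v] by (simp add: form_def)
  then show ?thesis
    using matrix_left_invertible_ker[of G] invertible_left_inverse by blast
qed

lemma skew_of_orthogonal_acs:
  assumes "\<And>v. J *v (J *v v) = - v" "\<And>u v. form G (J *v u) (J *v v) = form G u v"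
  shows "form G (J *v u) v = - form G u (J *v v)"
  using assms(2)[of "J *v u" v] assms(1) by (simp add: form_simps)

end

text \<open>The anticommutator is scalar because \<open>J\<close> and \<open>J'\<close> induce the same orientation
  (\<open>same_orientation_anticommutator\<close>); \<open>f\<close> is the cosine of the angle between their two forms. If
  \<open>f\<^sup>2 < 1\<close>, then \<open>J'\<close>, \<open>L\<close>, \<open>M = J' L\<close> anticommute pairwise and, up to the length
  \<open>sqrt (1 - f\<^sup>2)\<close> of \<open>L\<close> and \<open>M\<close>, form a quaternionic triple.\<close>

locale acs_pair = pos_def G for G :: "real^4^4" +
  fixes J J' :: "real^4^4" and f :: real
  assumes JJ: "J *v (J *v v) = - v" and J'J': "J' *v (J' *v v) = - v"
    and orthJ: "form G (J *v u) (J *v v) = form G u v"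
    and orthJ': "form G (J' *v u) (J' *v v) = form G u v"
    and anticomm: "J *v (J' *v v) + J' *v (J *v v) = - (2 * f) *\<^sub>R v"
begin

text \<open>\<open>M\<close> is the part of \<open>J\<close> that is trace-orthogonal to
  \<open>J'\<close>. By \<open>anticomm\<close>, \<open>L\<close> is half the commutator of
  \<open>J\<close> and \<open>J'\<close>, so it is skew and anticommutes with both.\<close>

definition "M = J - f *\<^sub>R J'"
definition "L = J ** J' + f *\<^sub>R mat 1"

lemma JJ'_swap: "J *v (J' *v v) = - (2 * f) *\<^sub>R v - J' *v (J *v v)"
  using anticomm[of v] by (simp add: algebra_simps)

lemma skewJ: "form G (J *v u) v = - form G u (J *v v)"
  by (rule skew_of_orthogonal_acs[OF JJ orthJ])

lemma skewJ': "form G (J' *v u) v = - form G u (J' *v v)"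
  by (rule skew_of_orthogonal_acs[OF J'J' orthJ'])

lemma M_mv: "M *v v = J *v v - f *\<^sub>R (J' *v v)"
  by (simp add: M_def mv_simps)

lemma L_mv: "L *v v = J *v (J' *v v) + f *\<^sub>R v"
  by (simp add: L_def mv_simps)

lemma J'L: "J' *v (L *v v) = M *v v"
  unfolding L_mv M_mv JJ'_swap mv_simps J'J' by (simp add: vec_eq_iff algebra_simps)

lemma J'M: "J' *v (M *v v) = - (L *v v)"
  using J'J'[of "L *v v"] by (simp add: J'L)

lemma LJ': "L *v (J' *v v) = - (M *v v)"
  unfolding L_mv M_mv mv_simps J'J' by (simp add: algebra_simps)

lemma MJ': "M *v (J' *v v) = L *v v"
  unfolding L_mv M_mv mv_simps J'J' by (simp add: algebra_simps)

lemma JL: "J *v (L *v v) = - (L *v (J *v v))"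
  unfolding L_mv mv_simps JJ JJ'_swap[of "v"] JJ'_swap[of "J *v v"] by (simp add: vec_eq_iff algebra_simps)

lemma LL: "L *v (L *v v) = - (1 - f\<^sup>2) *\<^sub>R v"
proof -
  have "L *v (L *v v) = J *v (M *v v) + f *\<^sub>R (L *v v)"
    by (subst L_mv) (simp add: J'L)
  also have "\<dots> = - (1 - f\<^sup>2) *\<^sub>R v"
    unfolding M_mv L_mv mv_simps JJ by (simp add: algebra_simps power2_eq_square)
  finally show ?thesis .
qed

lemma skewM: "form G (M *v u) v = - form G u (M *v v)"
  by (simp add: M_mv form_simps skewJ skewJ')

lemma skewL: "form G (L *v u) v = - form G u (L *v v)"
  unfolding L_mv form_simps skewJ skewJ' JJ'_swap[of v] by simp

lemma normL: "form G (L *v v) (L *v v) = (1 - f\<^sup>2) * form G v v"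
  using skewL[of v "L *v v"] by (simp only: LL form_simps)

lemma normM: "form G (M *v v) (M *v v) = (1 - f\<^sup>2) * form G v v"
  using orthJ'[of "L *v v" "L *v v"] normL by (simp add: J'L)

lemma orthLM: "form G (L *v v) (M *v v) = 0"
  using skewJ'[of "L *v v" "L *v v"] sym[of "L *v v" "M *v v"] by (simp add: J'L)

lemma f_le_1: "f\<^sup>2 \<le> 1"
proof -
  have "form G (axis 1 1) (axis 1 1) > 0" by (rule pos) (simp add: axis_eq_0_iff)
  then show ?thesis
    using normL[of "axis 1 1"] form_self_nonneg[of "L *v axis 1 1"] by (simp add: zero_le_mult_iff)
qed

text \<open>By \<open>normM\<close> every \<open>M v\<close> has length zero if
  \<open>f^2 = 1\<close>, and \<open>M = 0\<close> says that \<open>J = f J'\<close>.\<close>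

lemma eq_or_eq_minus:
  assumes "f\<^sup>2 = 1"
  shows "J' = f *\<^sub>R J"
proof -
  have "M *v v = 0" for v
    using normM[of v] assms by (simp add: form_self_eq_0)
  then have *: "J *v v = f *\<^sub>R (J' *v v)" for v by (simp add: M_mv)
  have "J' *v v = f *\<^sub>R (J *v v)" for v unfolding * using assms by (simp add: power2_eq_square)
  then show ?thesis by (simp add: matrix_eq mv_simps)
qed

end

locale acs_pair_generic = acs_pair +
  assumes f_lt: "f\<^sup>2 < 1"
begin

text \<open>Any nonzero \<open>v\<close> generates the orthogonal frame \<open>v\<close>,
  \<open>J' v\<close>, \<open>L v\<close>, \<open>M v\<close>, so an endomorphism commuting with the
  quaternions is determined by its value at one vector.\<close>

lemma orthogonal_quadruple:
  "form G v (J' *v v) = 0" "form G v (L *v v) = 0" "form G v (M *v v) = 0"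
  "form G (J' *v v) (L *v v) = 0" "form G (J' *v v) (M *v v) = 0" "form G (L *v v) (M *v v) = 0"
  "form G (J' *v v) (J' *v v) = form G v v"
proof -
  have skew0: "form G v (A *v v) = 0" if "\<And>u v. form G (A *v u) v = - form G u (A *v v)" for A v
    using that[of v v] sym[of "A *v v" v] by simp
  show "form G v (J' *v v) = 0" "form G v (L *v v) = 0" "form G v (M *v v) = 0"
    using skew0 skewJ' skewL skewM by blast+
  show "form G (J' *v v) (L *v v) = 0"
    using skewJ'[of v "L *v v"] skew0[OF skewM, of v] by (simp add: J'L)
  show "form G (J' *v v) (M *v v) = 0"
    using skewJ'[of v "M *v v"] skew0[OF skewL, of v] by (simp add: J'M form_simps)
  show "form G (L *v v) (M *v v) = 0" by (rule orthLM)
  show "form G (J' *v v) (J' *v v) = form G v v" by (rule orthJ')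
qed

lemma quadruple_coeff:
  fixes p q r s :: real
  assumes w: "w = p *\<^sub>R v + q *\<^sub>R (J' *v v) + r *\<^sub>R (L *v v) + s *\<^sub>R (M *v v)"
  shows "form G w v = p * form G v v" "form G w (J' *v v) = q * form G v v"
    "form G w (L *v v) = r * ((1 - f\<^sup>2) * form G v v)" "form G w (M *v v) = s * ((1 - f\<^sup>2) * form G v v)"
  using orthogonal_quadruple[of v] sym[of "J' *v v" v] sym[of "L *v v" v] sym[of "M *v v" v]
    sym[of "L *v v" "J' *v v"] sym[of "M *v v" "J' *v v"] sym[of "M *v v" "L *v v"]
  unfolding w by (simp_all add: form_simps normL normM)

lemma span_quadruple:
  assumes "v \<noteq> 0"
  obtains p q r s where "w = p *\<^sub>R v + q *\<^sub>R (J' *v v) + r *\<^sub>R (L *v v) + s *\<^sub>R (M *v v)"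
proof -
  have ind: "p = 0 \<and> q = 0 \<and> r = 0 \<and> s = 0"
    if "p *\<^sub>R v + q *\<^sub>R (J' *v v) + r *\<^sub>R (L *v v) + s *\<^sub>R (M *v v) = 0" for p q r s
    using quadruple_coeff[OF that[symmetric]] pos[OF assms] f_lt unfolding form_0_left by simp
  show ?thesis
    by (rule span_four[of v "J' *v v" "L *v v" "M *v v" w]) (erule ind, erule that)
qed

text \<open>For \<open>A\<close> among \<open>J'\<close>, \<open>L\<close>, \<open>M\<close> the
  product \<open>S A\<close> is skew, as \<open>S\<close> is symmetric, \<open>A\<close> is skew and
  they commute. Hence \<open>S v\<close> is orthogonal to \<open>A v\<close> and so a multiple of
  \<open>v\<close>; commutation carries the factor over to the whole frame generated by
  \<open>v\<close>.\<close>

lemma commuting_symmetric_scalar: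
  assumes S_sym: "\<And>u v. form G (S *v u) v = form G u (S *v v)"
    and SJ': "\<And>v. S *v (J' *v v) = J' *v (S *v v)"
    and SL: "\<And>v. S *v (L *v v) = L *v (S *v v)"
  obtains p where "\<And>v. S *v v = p *\<^sub>R v"
proof -
  have SM: "S *v (M *v v) = M *v (S *v v)" for v
    by (metis SJ' SL J'L)
  define v :: "real^4" where "v = axis 1 1"
  have v0: "v \<noteq> 0" by (simp add: v_def axis_eq_0_iff)
  have z: "form G (S *v v) (A *v v) = 0"
    if "\<And>u v. form G (A *v u) v = - form G u (A *v v)" "\<And>v. S *v (A *v v) = A *v (S *v v)" for A
    using that(1)[of v "S *v v"] S_sym[of "A *v v" v] S_sym[of v "A *v v"] sym that(2)[of v] by (smt (verit))
  obtain p q r s where w: "S *v v = p *\<^sub>R v + q *\<^sub>R (J' *v v) + r *\<^sub>R (L *v v) + s *\<^sub>R (M *v v)"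
    using span_quadruple[OF v0] by blast
  have "q = 0" "r = 0" "s = 0"
    using quadruple_coeff[OF w] z[OF skewJ' SJ'] z[OF skewL SL] z[OF skewM SM] pos[OF v0] f_lt by simp_all
  then have Sv: "S *v v = p *\<^sub>R v" using w by simp
  have "S *v w = p *\<^sub>R w" for w
  proof -
    obtain p' q r s where w: "w = p' *\<^sub>R v + q *\<^sub>R (J' *v v) + r *\<^sub>R (L *v v) + s *\<^sub>R (M *v v)"
      using span_quadruple[OF v0] by blast
    show ?thesis unfolding w by (simp add: mv_simps SJ' SL SM Sv algebra_simps)
  qed
  then show ?thesis using that by blast
qed

text \<open>Multiplying by \<open>L\<close> turns the part of \<open>E\<close> that anticommutes with both \<open>J\<close> and \<open>J'\<close> into a
  symmetric endomorphism commuting with the quaternions.\<close>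

lemma skew_anticommuting_decomp:
  assumes E_skew: "\<And>u v. form G (E *v u) v = - form G u (E *v v)"
    and EJ': "\<And>v. E *v (J' *v v) = - (J' *v (E *v v))"
    and EJ: "\<And>v. J *v (E *v v) + E *v (J *v v) = - (2 * c) *\<^sub>R v"
  obtains b where "\<And>v. E *v v = (c / (1 - f\<^sup>2)) *\<^sub>R (M *v v) + b *\<^sub>R (L *v v)"
proof -
  \<comment> \<open>The multiple of \<open>M\<close> with the same anticommutator with
    \<open>J\<close> as \<open>E\<close>, because \<open>J M + M J = - 2 (1 - f^2)\<close>; the
    remainder \<open>Q\<close> then anticommutes with \<open>J\<close>.\<close>
  define a where "a = c / (1 - f\<^sup>2)"
  have a: "a * (1 - f\<^sup>2) = c" using f_lt by (simp add: a_def)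
  define Q where "Q = E - a *\<^sub>R M"
  have Q: "Q *v v = E *v v - a *\<^sub>R (M *v v)" for v by (simp add: Q_def mv_simps)
  have Q_skew: "form G (Q *v u) v = - form G u (Q *v v)" for u v
    by (simp add: Q form_simps E_skew skewM)
  have QJ': "Q *v (J' *v v) = - (J' *v (Q *v v))" for v
    by (simp add: Q mv_simps EJ' MJ' J'M)
  have JM: "J *v (M *v v) + M *v (J *v v) = - (2 * (1 - f\<^sup>2)) *\<^sub>R v" for v
    unfolding M_mv mv_simps JJ JJ'_swap[of v] by (simp add: vec_eq_iff algebra_simps power2_eq_square)
  have QJ: "J *v (Q *v v) = - (Q *v (J *v v))" for v
  proof -
    have "J *v (Q *v v) + Q *v (J *v v) = (J *v (E *v v) + E *v (J *v v)) - a *\<^sub>R (J *v (M *v v) + M *v (J *v v))"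
      by (simp add: Q mv_simps algebra_simps)
    also have "\<dots> = 0"
      unfolding EJ JM a[symmetric] by (simp add: vec_eq_iff algebra_simps)
    finally show ?thesis by (simp add: add_eq_0_iff)
  qed
  have QL: "Q *v (L *v v) = L *v (Q *v v)" for v
    unfolding L_mv mv_simps using QJ[of "J' *v v"] QJ'[of v] by (simp add: mv_simps)
  define S where "S = Q ** L"
  have S: "S *v v = Q *v (L *v v)" for v by (simp add: S_def mv_simps)
  have S_sym: "form G (S *v u) v = form G u (S *v v)" for u v
    by (simp add: S Q_skew skewL QL)
  have SJ': "S *v (J' *v v) = J' *v (S *v v)" for v
    using QJ'[of "L *v v"] by (simp add: S LJ' J'L mv_simps)
  have SL: "S *v (L *v v) = L *v (S *v v)" for v by (simp add: S QL)
  obtain p where p: "\<And>v. S *v v = p *\<^sub>R v" using commuting_symmetric_scalar[OF S_sym SJ' SL] by blast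
  have "Q *v v = (- p / (1 - f\<^sup>2)) *\<^sub>R (L *v v)" for v
  proof -
    have eq: "- (1 - f\<^sup>2) *\<^sub>R (Q *v v) = p *\<^sub>R (L *v v)"
      using p[of "L *v v"] by (simp only: S LL mv_simps)
    have c: "- 1 / (1 - f\<^sup>2) * - (1 - f\<^sup>2) = 1" using f_lt by (simp add: divide_simps)
    have "Q *v v = (- 1 / (1 - f\<^sup>2)) *\<^sub>R (- (1 - f\<^sup>2) *\<^sub>R (Q *v v))"
      unfolding scaleR_scaleR c by simp
    then show ?thesis unfolding eq by simp
  qed
  then have "E *v v = a *\<^sub>R (M *v v) + (- p / (1 - f\<^sup>2)) *\<^sub>R (L *v v)" for v
    using Q[of v] by (simp add: algebra_simps)
  then show ?thesis using that unfolding a_def by blast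
qed

text \<open>The hypothesis is closedness of the fundamental form of \<open>J'\<close> when its
  covariant derivative along \<open>X\<close> is \<open>a X\<close> times \<open>M\<close> plus
  \<open>b X\<close> times \<open>L\<close>. For \<open>Z = J' Y\<close> the first two terms vanish
  and the rest pairs a combination of \<open>L Y\<close> and \<open>M Y\<close> with
  \<open>X\<close>; \<open>X = M Y\<close> picks out the coefficient of \<open>M Y\<close>.\<close>

lemma closed_imp_conjugate:
  fixes a b :: "real^4 \<Rightarrow> real"
  assumes cyc: "\<And>X Y Z. a X * form G (M *v Y) Z + b X * form G (L *v Y) Z
      + (a Y * form G (M *v Z) X + b Y * form G (L *v Z) X)
      + (a Z * form G (M *v X) Y + b Z * form G (L *v X) Y) = 0"
    and Y: "Y \<noteq> 0"
  shows "b Y = - a (J' *v Y)"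
proof -
  have z: "form G (M *v Y) (J' *v Y) = 0" "form G (L *v Y) (J' *v Y) = 0"
    using orthogonal_quadruple[of Y] sym by metis+
  have "(a Y - b (J' *v Y)) * form G (L *v Y) X - (b Y + a (J' *v Y)) * form G (M *v Y) X = 0" for X
    using cyc[of X Y "J' *v Y"] z skewM[of X Y] skewL[of X Y] sym[of X "M *v Y"] sym[of X "L *v Y"]
    by (simp add: MJ' LJ' form_simps algebra_simps)
  from this[of "M *v Y"] have "(b Y + a (J' *v Y)) * ((1 - f\<^sup>2) * form G Y Y) = 0"
    using orthLM[of Y] by (simp add: normM)
  then show ?thesis using f_lt pos[OF Y] by auto
qed

end

section \<open>Orientation and self-duality in dimension four\<close>

lemma vector_4:
  fixes w x y z :: "'a::zero"
  shows "(vector [w, x, y, z] :: 'a^4)$1 = w" "(vector [w, x, y, z] :: 'a^4)$2 = x"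
    "(vector [w, x, y, z] :: 'a^4)$3 = y" "(vector [w, x, y, z] :: 'a^4)$4 = z"
  unfolding vector_def by simp_all

lemma det_4:
  "det (A::'a::comm_ring_1^4^4) =
    A$1$1 * (A$2$2 * (A$3$3 * A$4$4 - A$3$4 * A$4$3) - A$2$3 * (A$3$2 * A$4$4 - A$3$4 * A$4$2)
      + A$2$4 * (A$3$2 * A$4$3 - A$3$3 * A$4$2))
    - A$1$2 * (A$2$1 * (A$3$3 * A$4$4 - A$3$4 * A$4$3) - A$2$3 * (A$3$1 * A$4$4 - A$3$4 * A$4$1)
      + A$2$4 * (A$3$1 * A$4$3 - A$3$3 * A$4$1))
    + A$1$3 * (A$2$1 * (A$3$2 * A$4$4 - A$3$4 * A$4$2) - A$2$2 * (A$3$1 * A$4$4 - A$3$4 * A$4$1)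
      + A$2$4 * (A$3$1 * A$4$2 - A$3$2 * A$4$1))
    - A$1$4 * (A$2$1 * (A$3$2 * A$4$3 - A$3$3 * A$4$2) - A$2$2 * (A$3$1 * A$4$3 - A$3$3 * A$4$1)
      + A$2$3 * (A$3$1 * A$4$2 - A$3$2 * A$4$1))"
proof -
  have f1234: "finite {2::4, 3, 4}" "1 \<notin> {2::4, 3, 4}" by auto
  have f234: "finite {3::4, 4}" "2 \<notin> {3::4, 4}" by auto
  have f34: "finite {4::4}" "3 \<notin> {4::4}" by auto
  show ?thesis
    unfolding det_def UNIV_4
    unfolding sum_over_permutations_insert[OF f1234]
    unfolding sum_over_permutations_insert[OF f234]
    unfolding sum_over_permutations_insert[OF f34]
    unfolding permutes_sing
    by (simp add: sign_swap_id permutation_swap_id permutation_compose sign_compose sign_id swap_id_eq algebra_simps)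
qed

definition pfaffian :: "real^4^4 \<Rightarrow> real" where
  "pfaffian A = A$1$2 * A$3$4 - A$1$3 * A$2$4 + A$1$4 * A$2$3"

text \<open>The variables are the entries above the diagonal of a skew matrix, row by row, and the
  hypotheses are entries of its square. The Pfaffian \<open>p\<close> has square 1, and the squared
  deviations from the two self-duality patterns are \<open>2 - 2 p\<close> and
  \<open>2 + 2 p\<close>, one of which is zero.\<close>

lemma skew_square_minus_one_entries:
  fixes a b c d e h :: real
  assumes "a\<^sup>2 + b\<^sup>2 + c\<^sup>2 = 1" "a\<^sup>2 + d\<^sup>2 + e\<^sup>2 = 1" "b\<^sup>2 + d\<^sup>2 + h\<^sup>2 = 1" "c\<^sup>2 + e\<^sup>2 + h\<^sup>2 = 1"
    and o: "b * d + c * e = 0" "a * d - c * h = 0" "a * e + b * h = 0"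
  shows "a * h - b * e + c * d = 1 \<and> h = a \<and> e = - b \<and> d = c \<or>
    a * h - b * e + c * d = - 1 \<and> h = - a \<and> e = b \<and> d = - c"
proof -
  have sq: "h\<^sup>2 = a\<^sup>2" "e\<^sup>2 = b\<^sup>2" "d\<^sup>2 = c\<^sup>2" using assms(1-4) by linarith+
  have o': "a * e = - (b * h)" "c * h = a * d" "c * e = - (b * d)" using o by linarith+
  have z: "x = 0 \<and> y = 0 \<and> z = 0" if "x\<^sup>2 + y\<^sup>2 + z\<^sup>2 = 0" for x y z :: real
    using that by (smt (verit) zero_le_power2 zero_eq_power2)
  define p where "p = a * h - b * e + c * d"
  have "p\<^sup>2 = a\<^sup>2 * h\<^sup>2 + b\<^sup>2 * e\<^sup>2 + c\<^sup>2 * d\<^sup>2 - 2 * ((a * e) * (b * h)) + 2 * ((a * d) * (c * h)) - 2 * ((b * d) * (c * e))"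
    by (simp add: p_def power2_eq_square algebra_simps)
  also have "\<dots> = a\<^sup>2 * h\<^sup>2 + b\<^sup>2 * e\<^sup>2 + c\<^sup>2 * d\<^sup>2 + 2 * (b\<^sup>2 * h\<^sup>2) + 2 * (a\<^sup>2 * d\<^sup>2) + 2 * (b\<^sup>2 * d\<^sup>2)"
    unfolding o'
    by (simp add: power2_eq_square algebra_simps)
  also have "\<dots> = (a\<^sup>2 + b\<^sup>2 + c\<^sup>2)\<^sup>2" unfolding sq by (simp add: power2_eq_square algebra_simps)
  finally have "p\<^sup>2 = 1" using assms(1) by simp
  then consider "p = 1" | "p = -1" using power2_eq_1_iff by blast
  then show ?thesis
  proof cases
    case 1
    have q: "(a - h)\<^sup>2 + (b + e)\<^sup>2 + (c - d)\<^sup>2 = 2 - 2 * p"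
      using assms(1) sq by (simp add: p_def power2_eq_square algebra_simps)
    have "a - h = 0 \<and> b + e = 0 \<and> c - d = 0" by (rule z) (use q 1 in simp)
    then have "h = a \<and> e = - b \<and> d = c" by linarith
    then show ?thesis using 1 unfolding p_def by blast
  next
    case 2
    have q: "(a + h)\<^sup>2 + (b - e)\<^sup>2 + (c + d)\<^sup>2 = 2 + 2 * p"
      using assms(1) sq by (simp add: p_def power2_eq_square algebra_simps)
    have "a + h = 0 \<and> b - e = 0 \<and> c + d = 0" by (rule z) (use q 2 in simp)
    then have "h = - a \<and> e = b \<and> d = - c" by linarith
    then show ?thesis using 2 unfolding p_def by blast
  qed
qed

text \<open>For \<open>s = 1\<close> these are the self-dual, for \<open>s = - 1\<close> the anti-self-dual skew matrices.\<close>

definition self_dual :: "real \<Rightarrow> real^4^4 \<Rightarrow> bool" where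
  "self_dual s A \<longleftrightarrow> (\<forall>i. A$i$i = 0) \<and>
    A$2$1 = - A$1$2 \<and> A$3$1 = - A$1$3 \<and> A$4$1 = - A$1$4 \<and>
    A$2$3 = s * A$1$4 \<and> A$2$4 = - s * A$1$3 \<and> A$3$4 = s * A$1$2 \<and>
    A$3$2 = - s * A$1$4 \<and> A$4$2 = s * A$1$3 \<and> A$4$3 = - s * A$1$2"

text \<open>For either sign these matrices represent the imaginary quaternions, whose anticommutator
  is minus twice the inner product.\<close>

lemma self_dual_anticommutator:
  assumes s: "s * s = 1" and A: "self_dual s A" and B: "self_dual s B"
  shows "A *v (B *v v) + B *v (A *v v) = - (2 * (A$1$2 * B$1$2 + A$1$3 * B$1$3 + A$1$4 * B$1$4)) *\<^sub>R v"
proof -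
  have ss: "s * (s * x) = x" for x using s by (simp add: mult.assoc[symmetric])
  have "x * (s * (y * (s * z))) = x * (y * z)" for x y z using ss by (simp add: mult.left_commute)
  with A B show ?thesis
    by (simp add: self_dual_def vec_eq_iff forall_4 matrix_vector_mult_def sum_4) (simp add: algebra_simps ss)
qed

text \<open>The orientation is read off from the determinants with \<open>u = e\<^sub>1\<close>, \<open>v = e\<^sub>2, e\<^sub>3, e\<^sub>4\<close>,
  which add up to twice the Pfaffian.\<close>

lemma skew_acs_entries:
  fixes A :: "real^4^4"
  assumes skew: "\<And>u v. (A *v u) \<bullet> v = - (u \<bullet> (A *v v))" and sq: "\<And>v. A *v (A *v v) = - v"
    and ori: "\<And>u v. det (vector [u, A *v u, v, A *v v] :: real^4^4) \<noteq> 0 \<Longrightarrow>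
      sgn (det (vector [u, A *v u, v, A *v v] :: real^4^4)) = s"
  shows "s * s = 1" "self_dual s A"
proof -
  have sk: "A$i$j = - A$j$i" for i j
    using skew[of "axis j 1" "axis i 1"] by (simp add: inner_axis inner_axis' matrix_vector_mul_component)
  have dg: "A$i$i = 0" for i using sk[of i i] by simp
  have sk': "A$2$1 = - A$1$2" "A$3$1 = - A$1$3" "A$4$1 = - A$1$4" "A$3$2 = - A$2$3" "A$4$2 = - A$2$4" "A$4$3 = - A$3$4"
    using sk by blast+
  note ent = dg sk'
  have col: "A *v axis j 1 = (\<chi> i. A$i$j)" for j
    by (simp add: vec_eq_iff matrix_vector_mul_component inner_axis)
  have s2: "(\<Sum>k\<in>UNIV. A$i$k * A$k$j) = - (if i = j then 1 else 0)" for i j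
  proof -
    have "(A *v (A *v axis j 1)) $ i = - (axis j 1 $ i :: real)" using sq[of "axis j 1"] by simp
    then show ?thesis unfolding col by (simp add: matrix_vector_mult_def axis_def)
  qed
  have e: "A$1$2 * A$3$4 - A$1$3 * A$2$4 + A$1$4 * A$2$3 = 1 \<and> A$3$4 = A$1$2 \<and> A$2$4 = - A$1$3 \<and> A$2$3 = A$1$4 \<or>
    A$1$2 * A$3$4 - A$1$3 * A$2$4 + A$1$4 * A$2$3 = - 1 \<and> A$3$4 = - A$1$2 \<and> A$2$4 = A$1$3 \<and> A$2$3 = - A$1$4"
    using s2[of 1 1] s2[of 2 2] s2[of 3 3] s2[of 4 4] s2[of 1 2] s2[of 1 3] s2[of 1 4]
    by (intro skew_square_minus_one_entries) (auto simp: sum_4 ent power2_eq_square algebra_simps)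
  define d where "d j = det (vector [axis 1 1, A *v axis 1 1, axis j 1, A *v axis j 1] :: real^4^4)" for j
  have d: "d 2 + d 3 + d 4 = 2 * pfaffian A"
    unfolding d_def col det_4 pfaffian_def by (simp add: vector_4 axis_def ent algebra_simps)
  have ds: "d j \<noteq> 0 \<Longrightarrow> sgn (d j) = s" for j unfolding d_def by (rule ori)
  have pf: "pfaffian A = 1 \<or> pfaffian A = -1" using e unfolding pfaffian_def by auto
  have "pfaffian A = s"
  proof -
    \<comment> \<open>The three determinants add up to 2 or -2, so one of them is nonzero and makes
      \<open>s\<close> a sign; none has the opposite sign, hence the Pfaffian has the sign
      \<open>s\<close>.\<close>
    obtain j where "d j \<noteq> 0" using d pf by fastforce
    then have "s = 1 \<or> s = -1" using ds by (metis sgn_real_def)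
    moreover have "s = 1 \<Longrightarrow> d j \<ge> 0" "s = -1 \<Longrightarrow> d j \<le> 0" for j
      using ds[of j] by (cases "d j" "0::real" rule: linorder_cases; simp)+
    ultimately show ?thesis using d pf by (smt (verit))
  qed
  then show "s * s = 1" "self_dual s A"
    using e pf unfolding pfaffian_def self_dual_def by (auto simp: ent)
qed

text \<open>The columns of \<open>S\<close> are \<open>u\<close>, \<open>J u\<close>,
  \<open>z\<close>, \<open>J z\<close>. Since \<open>J\<close> is orthogonal and skew, a single
  Gram-Schmidt step, making \<open>z\<close> orthogonal to \<open>u\<close> and \<open>J u\<close>,
  is enough.\<close>

lemma orthonormal_frame:
  fixes G :: "real^4^4"
  assumes pd: "pos_def G" and J: "\<And>v. J *v (J *v v) = - v" "\<And>u v. form G (J *v u) (J *v v) = form G u v"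
  obtains S :: "real^4^4" where "\<And>x y. form G (S *v x) (S *v y) = x \<bullet> y"
proof -
  interpret pos_def G by (rule pd)
  note skewJ = skew_of_orthogonal_acs[OF J]
  have normalize: "\<exists>c. form G (c *\<^sub>R v) (c *\<^sub>R v) = 1" if "v \<noteq> 0" for v
    using pos[OF that] by (intro exI[of _ "1 / sqrt (form G v v)"]) (simp add: form_simps field_simps)
  have vJv: "form G v (J *v v) = 0" "form G (J *v v) v = 0" for v
    using skewJ[of v v] sym[of v "J *v v"] by simp_all
  have "axis 1 1 \<noteq> (0 :: real^4)" by (simp add: axis_eq_0_iff)
  then obtain u where u: "form G u u = 1" using normalize by blast
  have "\<exists>v. v \<notin> span {u, J *v u}"
  proof (rule ccontr)
    assume "\<not> ?thesis"
    then have "dim (UNIV :: (real^4) set) \<le> card {u, J *v u}"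
      by (intro dim_le_card) auto
    then show False using card_insert_le_m1[of 2 "{J *v u}" u] by (simp add: dim_UNIV)
  qed
  then obtain v where v: "v \<notin> span {u, J *v u}" by blast
  define w where "w = v - form G v u *\<^sub>R u - form G v (J *v u) *\<^sub>R (J *v u)"
  have "w \<noteq> 0"
  proof
    assume "w = 0"
    then have "v = form G v u *\<^sub>R u + form G v (J *v u) *\<^sub>R (J *v u)" by (simp add: w_def algebra_simps)
    then show False using v by (metis insertCI span_add span_base span_scale)
  qed
  then obtain c where c: "form G (c *\<^sub>R w) (c *\<^sub>R w) = 1" using normalize by blast
  define z where "z = c *\<^sub>R w"
  have z: "form G z z = 1" "form G z u = 0" "form G z (J *v u) = 0"
    using c u J(2)[of u u] vJv by (simp_all add: z_def w_def form_simps)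
  have z': "form G u z = 0" "form G (J *v u) z = 0" "form G (J *v z) u = 0" "form G u (J *v z) = 0"
    "form G (J *v z) (J *v u) = 0" "form G (J *v u) (J *v z) = 0"
    using z sym skewJ J(2) by (metis minus_zero)+
  define S :: "real^4^4" where "S = transpose (vector [u, J *v u, z, J *v z])"
  have S: "S *v x = x $ 1 *\<^sub>R u + x $ 2 *\<^sub>R (J *v u) + x $ 3 *\<^sub>R z + x $ 4 *\<^sub>R (J *v z)" for x
    by (simp add: S_def vec_eq_iff matrix_vector_mult_def transpose_def sum_4 vector_4 algebra_simps)
  show ?thesis
    by (rule that[of S]) (simp add: S form_simps z z' u vJv J(2) inner_vec_def sum_4 algebra_simps)
qed

text \<open>An orthonormal frame turns \<open>J\<close> and \<open>J'\<close> into skew matrices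
  that are both self-dual or both anti-self-dual, so \<open>self_dual_anticommutator\<close>
  applies. Their type is \<open>sgn (det T) * s\<close> instead of \<open>s\<close> because the
  frame may reverse the orientation.\<close>

lemma same_orientation_anticommutator:
  fixes G J J' :: "real^4^4"
  assumes pd: "pos_def G"
    and J: "\<And>v. J *v (J *v v) = - v" "\<And>u v. form G (J *v u) (J *v v) = form G u v"
    and J': "\<And>v. J' *v (J' *v v) = - v" "\<And>u v. form G (J' *v u) (J' *v v) = form G u v"
    and ori: "\<And>u v. det (vector [u, J *v u, v, J *v v] :: real^4^4) \<noteq> 0 \<Longrightarrow>
      sgn (det (vector [u, J *v u, v, J *v v] :: real^4^4)) = s"
    and ori': "\<And>u v. det (vector [u, J' *v u, v, J' *v v] :: real^4^4) \<noteq> 0 \<Longrightarrow>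
      sgn (det (vector [u, J' *v u, v, J' *v v] :: real^4^4)) = s"
  obtains f where "\<And>v. J *v (J' *v v) + J' *v (J *v v) = - (2 * f) *\<^sub>R v"
proof -
  interpret pos_def G by (rule pd)
  obtain S :: "real^4^4" where S: "\<And>x y. form G (S *v x) (S *v y) = x \<bullet> y" using orthonormal_frame[OF pd J] by blast
  have "x = 0" if "S *v x = 0" for x using S[of x x] that by (simp add: form_simps)
  then obtain T where T: "T ** S = mat 1" using matrix_left_invertible_ker[of S] by blast
  then have T': "S ** T = mat 1" using matrix_left_right_inverse by blast
  have TS: "T *v (S *v v) = v" "S *v (T *v v) = v" for v
    using T T' by (simp_all add: matrix_vector_mul_assoc)
  have dT: "det T \<noteq> 0" using T' invertible_det_nz invertible_left_inverse by blast
  define P where "P K = T ** K ** S" for K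
  have P: "P K *v v = T *v (K *v (S *v v))" for K v by (simp add: P_def mv_simps)
  have std: "sgn (det T) * s * (sgn (det T) * s) = 1" "self_dual (sgn (det T) * s) (P K)"
    if K: "\<And>v. K *v (K *v v) = - v" "\<And>u v. form G (K *v u) (K *v v) = form G u v"
      and o: "\<And>u v. det (vector [u, K *v u, v, K *v v] :: real^4^4) \<noteq> 0 \<Longrightarrow>
        sgn (det (vector [u, K *v u, v, K *v v] :: real^4^4)) = s" for K
  proof -
    have 1: "(P K *v u) \<bullet> v = - (u \<bullet> (P K *v v))" for u v
      unfolding S[symmetric] P TS by (rule skew_of_orthogonal_acs[OF K])
    have 2: "P K *v (P K *v v) = - v" for v unfolding P TS K by (simp add: TS mv_simps)
    have 3: "sgn (det (vector [u, P K *v u, v, P K *v v] :: real^4^4)) = sgn (det T) * s"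
      if nz: "det (vector [u, P K *v u, v, P K *v v] :: real^4^4) \<noteq> 0" for u v
    proof -
    have "(vector [u, P K *v u, v, P K *v v] :: real^4^4) =
        vector [S *v u, K *v (S *v u), S *v v, K *v (S *v v)] ** transpose T"
    proof -
      have *: "(vector [a, b, c, d] :: real^4^4) ** transpose T = vector [T *v a, T *v b, T *v c, T *v d]" for a b c d
        by (simp add: vec_eq_iff forall_4 vector_4 matrix_matrix_mult_def matrix_vector_mult_def transpose_def
            mult.commute)
      show ?thesis unfolding * P TS ..
    qed
    then have d: "det (vector [u, P K *v u, v, P K *v v] :: real^4^4) =
        det (vector [S *v u, K *v (S *v u), S *v v, K *v (S *v v)] :: real^4^4) * det T"
      by (simp add: det_mul det_transpose)
      show ?thesis
        using o[of "S *v u" "S *v v"] nz unfolding d by (simp add: sgn_mult)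
    qed
    show "sgn (det T) * s * (sgn (det T) * s) = 1" "self_dual (sgn (det T) * s) (P K)"
      using skew_acs_entries[OF 1 2 3] by blast+
  qed
  have "J *v (J' *v v) + J' *v (J *v v) = - (2 * f) *\<^sub>R v"
    if f: "f = P J$1$2 * P J'$1$2 + P J$1$3 * P J'$1$3 + P J$1$4 * P J'$1$4" for f v
  proof -
    have *: "P J *v (P J' *v (T *v v)) + P J' *v (P J *v (T *v v)) = - (2 * f) *\<^sub>R (T *v v)"
      unfolding f by (rule self_dual_anticommutator[OF std(1)[OF J ori] std(2)[OF J ori] std(2)[OF J' ori']])
    have "S *v (P J *v (P J' *v (T *v v)) + P J' *v (P J *v (T *v v))) = S *v (- (2 * f) *\<^sub>R (T *v v))"
      unfolding * ..
    then show ?thesis unfolding P TS mv_simps .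
  qed
  then show ?thesis using that by blast
qed


section \<open>Levi-Civita connection and curvature in a chart\<close>

lemma mm_add_left: "(A + B) ** C = A ** C + B ** C"
  and mm_add_right: "D ** (A + B) = D ** A + D ** B"
  and mm_diff_left: "(A - B) ** C = A ** C - B ** C"
  and mm_diff_right: "D ** (A - B) = D ** A - D ** B"
  and mm_scaleR_left: "(c *\<^sub>R A) ** C = c *\<^sub>R (A ** C)"
  and mm_scaleR_right: "D ** (c *\<^sub>R A) = c *\<^sub>R (D ** A)"
  and mm_uminus_left: "(- A) ** C = - (A ** C)"
  and mm_uminus_right: "D ** (- A) = - (D ** A)"
  for A B :: "real^'n^'m" and C :: "real^'p^'n" and D :: "real^'m^'q"
  by (simp_all add: matrix_eq mv_simps)

lemmas mm_simps = mm_add_left mm_add_right mm_diff_left mm_diff_right mm_scaleR_left mm_scaleR_right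
  mm_uminus_left mm_uminus_right

lemma bounded_bilinear_matrix_matrix_mult:
  "bounded_bilinear ((**) :: real^'n^'m \<Rightarrow> real^'p^'n \<Rightarrow> real^'p^'m)"
  unfolding bilinear_conv_bounded_bilinear[symmetric] bilinear_def
  by (auto intro!: linearI simp: mm_simps)

lemma bounded_bilinear_matrix_vector_mult:
  "bounded_bilinear ((*v) :: real^'n^'m \<Rightarrow> real^'n \<Rightarrow> real^'m)"
  unfolding bilinear_conv_bounded_bilinear[symmetric] bilinear_def
  by (auto intro!: linearI simp: mv_simps)

lemma bounded_linear_trace: "bounded_linear (trace :: real^'n^'n \<Rightarrow> real)"
  unfolding linear_conv_bounded_linear[symmetric]
  by (auto intro!: linearI simp: trace_def sum.distrib sum_distrib_left)

lemma form_add_matrix: "form (A + B) u v = form A u v + form B u v"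
  and form_scaleR_matrix: "form (c *\<^sub>R A) u v = c * form A u v"
  by (simp_all add: form_def mv_simps inner_simps)

text \<open>Bridge between index and vector notation: Christoffel symbols, curvature and
  \<open>ext_deriv2\<close> are given on coordinate vectors, while the later arguments use arbitrary
  ones.\<close>

lemma linear_zero_axis:
  fixes f :: "real^'n \<Rightarrow> 'b::real_vector"
  assumes "linear f" "\<And>i. f (axis i 1) = 0"
  shows "f v = 0"
proof -
  have "f b = 0" if "b \<in> Basis" for b
    using that assms(2) by (auto simp: Basis_vec_def)
  then show ?thesis
    using linear_eq_0_on_span[OF assms(1), of Basis v] by simp
qed

lemma bilinear_zero_axis:
  fixes f :: "real^'n \<Rightarrow> real^'n \<Rightarrow> 'b::real_vector"
  assumes "\<And>w. linear (\<lambda>v. f v w)" "\<And>v. linear (f v)" "\<And>i j. f (axis i 1) (axis j 1) = 0"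
  shows "f v w = 0"
  using linear_zero_axis[OF assms(1)] linear_zero_axis[OF assms(2)] assms(3) by metis

lemma trilinear_zero_axis:
  fixes f :: "real^'n \<Rightarrow> real^'n \<Rightarrow> real^'n \<Rightarrow> 'b::real_vector"
  assumes "\<And>v w. linear (\<lambda>u. f u v w)" "\<And>u w. linear (\<lambda>v. f u v w)" "\<And>u v. linear (f u v)"
    "\<And>i j k. f (axis i 1) (axis j 1) (axis k 1) = 0"
  shows "f u v w = 0"
proof -
  have "f (axis i 1) v w = 0" for i
    by (rule bilinear_zero_axis[of "f (axis i 1)"]) (use assms in auto)
  then show ?thesis using linear_zero_axis[OF assms(1)] by metis
qed

lemma trace_eq_sum_mv: "trace A = (\<Sum>i\<in>UNIV. (A *v axis i 1) $ i)" for A :: "real^'n^'n"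
  by (simp add: trace_def matrix_vector_mul_component inner_axis)

section \<open>Product rules for directional derivatives on a fixed open set\<close>

locale open_domain =
  fixes U :: "(real^'n) set"
  assumes open_U: "open U"
begin

lemmas smooth_mm = smooth_on_bilinear[OF open_U bounded_bilinear_matrix_matrix_mult]
lemmas smooth_mv = smooth_on_bilinear[OF open_U bounded_bilinear_matrix_vector_mult]
lemmas smooth_inner = smooth_on_bilinear[OF open_U bounded_bilinear_inner]
lemmas smooth_scaleR = smooth_on_scaleR[OF open_U]
lemmas smooth_mult = smooth_on_mult[OF open_U]
lemmas smooth_add = smooth_on_add[OF open_U]
lemmas smooth_diff = smooth_on_diff[OF open_U]
lemmas smooth_minus = smooth_on_minus[OF open_U]
lemmas smooth_trace = smooth_on_linear[OF open_U bounded_linear_trace]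
lemmas smooth_sum = smooth_on_sum[OF open_U]

lemma smooth_form:
  "smooth_on B U \<Longrightarrow> smooth_on p U \<Longrightarrow> smooth_on q U \<Longrightarrow> smooth_on (\<lambda>x. form (B x) (p x) (q x)) U"
  unfolding form_def by (intro smooth_inner smooth_mv)

lemmas smooth_intros = smooth_mm smooth_mv smooth_inner smooth_scaleR smooth_mult smooth_add smooth_diff
  smooth_minus smooth_trace smooth_sum smooth_form smooth_on_const smooth_on_dd

lemma dd_U_cong: "x \<in> U \<Longrightarrow> (\<And>y. y \<in> U \<Longrightarrow> f y = h y) \<Longrightarrow> dd v f x = dd v h x"
  by (rule dd_cong[OF open_U])

lemmas smooth_differentiable = smooth_on_differentiable[where S = U]

lemma dd_mm:
  fixes E :: "real^'n \<Rightarrow> real^'b^'a" and F :: "real^'n \<Rightarrow> real^'c^'b"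
  shows "x \<in> U \<Longrightarrow> smooth_on E U \<Longrightarrow> smooth_on F U \<Longrightarrow>
    dd v (\<lambda>x. E x ** F x) x = E x ** dd v F x + dd v E x ** F x"
  by (intro dd_bilinear bounded_bilinear_matrix_matrix_mult smooth_differentiable)

lemma dd_mv:
  fixes E :: "real^'n \<Rightarrow> real^'b^'a"
  shows "x \<in> U \<Longrightarrow> smooth_on E U \<Longrightarrow> smooth_on p U \<Longrightarrow>
    dd v (\<lambda>x. E x *v p x) x = E x *v dd v p x + dd v E x *v p x"
  by (intro dd_bilinear bounded_bilinear_matrix_vector_mult smooth_differentiable)

lemma dd_mv_const:
  fixes E :: "real^'n \<Rightarrow> real^'b^'a"
  shows "x \<in> U \<Longrightarrow> smooth_on E U \<Longrightarrow> dd v (\<lambda>x. E x *v X) x = dd v E x *v X"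
  using dd_mv[of x E "\<lambda>_. X" v] by simp

lemma dd_form: "x \<in> U \<Longrightarrow> smooth_on B U \<Longrightarrow> smooth_on p U \<Longrightarrow> smooth_on q U \<Longrightarrow>
    dd v (\<lambda>x. form (B x) (p x) (q x)) x =
      form (dd v B x) (p x) (q x) + form (B x) (dd v p x) (q x) + form (B x) (p x) (dd v q x)"
  unfolding form_def
  by (subst dd_bilinear[OF bounded_bilinear_inner])
     (auto intro!: smooth_differentiable smooth_mv simp: dd_mv inner_simps)

lemma dd_mult: "x \<in> U \<Longrightarrow> smooth_on a U \<Longrightarrow> smooth_on b U \<Longrightarrow>
    dd v (\<lambda>x. a x * b x) x = a x * dd v b x + dd v a x * (b x :: real)"
  by (intro dd_bilinear bounded_bilinear_mult smooth_differentiable)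

lemma dd_scaleR: "x \<in> U \<Longrightarrow> smooth_on a U \<Longrightarrow> smooth_on p U \<Longrightarrow>
    dd v (\<lambda>x. a x *\<^sub>R p x) x = a x *\<^sub>R dd v p x + dd v a x *\<^sub>R p x"
  by (intro dd_bilinear bounded_bilinear_scaleR smooth_differentiable)

lemma dd_plus: "x \<in> U \<Longrightarrow> smooth_on p U \<Longrightarrow> smooth_on q U \<Longrightarrow>
    dd v (\<lambda>x. p x + q x) x = dd v p x + dd v q x"
  by (intro dd_add smooth_differentiable)

lemma dd_minus: "x \<in> U \<Longrightarrow> smooth_on p U \<Longrightarrow> smooth_on q U \<Longrightarrow>
    dd v (\<lambda>x. p x - q x) x = dd v p x - dd v q x"
  by (intro dd_diff smooth_differentiable)

lemma dd_uminus: "x \<in> U \<Longrightarrow> smooth_on p U \<Longrightarrow> dd v (\<lambda>x. - p x) x = - dd v p x"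
  by (intro dd_linear[OF bounded_linear_minus[OF bounded_linear_ident]] smooth_differentiable)

lemma dd_trace:
  fixes E :: "real^'n \<Rightarrow> real^'a^'a"
  shows "x \<in> U \<Longrightarrow> smooth_on E U \<Longrightarrow> dd v (\<lambda>x. trace (E x)) x = trace (dd v E x)"
  by (intro dd_linear bounded_linear_trace smooth_differentiable)

lemma linear_dd_smooth: "x \<in> U \<Longrightarrow> smooth_on p U \<Longrightarrow> linear (\<lambda>v. dd v p x)"
  by (intro linear_dd smooth_differentiable)

end

locale riem_chart = open_domain +
  fixes g :: "real^'n \<Rightarrow> real^'n^'n"
  assumes smooth_g: "smooth_on g U"
    and pos_def_g: "x \<in> U \<Longrightarrow> pos_def (g x)"
begin

text \<open>The connection form evaluated on \<open>v\<close>: \<open>Gam v x *v w\<close> is the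
  covariant derivative along \<open>v\<close> of the constant field \<open>w\<close>. Matrices
  instead of three indices keep the curvature computations free of sums.\<close>

definition Gam :: "real^'n \<Rightarrow> real^'n \<Rightarrow> real^'n^'n" where
  "Gam v x = (\<chi> k j. \<Sum>i\<in>UNIV. v $ i * christoffel g k i j x)"

lemma form_sym: "x \<in> U \<Longrightarrow> form (g x) u v = form (g x) v u"
  using pos_def.sym[OF pos_def_g] .

lemma partial_g: "x \<in> U \<Longrightarrow> partial i (\<lambda>y. g y $ j $ l) x = dd (axis i 1) g x $ j $ l"
  unfolding partial_eq_dd
  using dd_linear[OF bounded_linear_compose[OF bounded_linear_vec_nth bounded_linear_vec_nth]
      smooth_differentiable[OF smooth_g]] .

lemma smooth_christoffel: "smooth_on (christoffel g k i j) U"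
proof -
  have inv: "smooth_on (\<lambda>x. matrix_inv (g x)) U"
    by (rule smooth_on_matrix_inv[OF open_U smooth_g pos_def.invertible_form[OF pos_def_g]])
  have "smooth_on (\<lambda>x. 1/2 * (\<Sum>l\<in>UNIV. matrix_inv (g x) $ k $ l *
        (dd (axis i 1) g x $ j $ l + dd (axis j 1) g x $ i $ l - dd (axis l 1) g x $ i $ j))) U"
    by (intro smooth_intros smooth_on_vec_nth[OF open_U] inv smooth_g)
  then show ?thesis
    by (rule smooth_on_cong[OF open_U, THEN iffD1, rotated]) (simp add: christoffel_def partial_g)
qed

lemma smooth_Gam: "smooth_on (Gam v) U"
  unfolding Gam_def[abs_def]
  by (intro smooth_on_vec open_U) (simp add: smooth_intros smooth_christoffel)

lemma Gam_axis: "Gam (axis i 1) x $ k $ j = christoffel g k i j x"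
  by (simp add: Gam_def axis_def if_distrib[of "\<lambda>u. u * _"] sum.delta cong: if_cong)

lemma linear_Gam: "linear (\<lambda>v. Gam v x)"
  by (rule linearI) (simp_all add: Gam_def vec_eq_iff algebra_simps sum.distrib sum_distrib_left)

lemma linear_dd_Gam: "x \<in> U \<Longrightarrow> linear (\<lambda>v. dd w (Gam v) x)"
proof (rule linearI)
  assume x: "x \<in> U"
  show "dd w (Gam (u + v)) x = dd w (Gam u) x + dd w (Gam v) x" for u v
    by (subst dd_plus[OF x smooth_Gam smooth_Gam, symmetric], rule dd_U_cong[OF x])
      (rule linear_add[OF linear_Gam])
  show "dd w (Gam (c *\<^sub>R v)) x = c *\<^sub>R dd w (Gam v) x" for c v
  proof -
    have "Gam (c *\<^sub>R v) = (\<lambda>y. c *\<^sub>R Gam v y)" by (rule ext) (rule linear_cmul[OF linear_Gam])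
    then show ?thesis using dd_scaleR[OF x smooth_on_const smooth_Gam, of w c v] by simp
  qed
qed

lemma dd_g_sym: "x \<in> U \<Longrightarrow> form (dd u g x) v w = form (dd u g x) w v"
proof -
  assume x: "x \<in> U"
  have "form (dd u g x) v w = dd u (\<lambda>x. form (g x) v w) x" for v w
    using dd_form[OF x smooth_g smooth_on_const smooth_on_const, of u v w] by (simp add: form_simps)
  moreover have "dd u (\<lambda>x. form (g x) v w) x = dd u (\<lambda>x. form (g x) w v) x"
    by (rule dd_U_cong[OF x]) (rule form_sym)
  ultimately show ?thesis by metis
qed

text \<open>Koszul's formula for constant fields, whose brackets vanish. It unfolds the Christoffel
  symbols once and for all; vanishing torsion and compatibility with the metric are read off from
  it.\<close>

lemma koszul:
  assumes x: "x \<in> U"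
  shows "form (g x) (Gam u x *v v) w =
    1/2 * (form (dd u g x) v w + form (dd v g x) u w - form (dd w g x) u v)"
proof -
  define F where "F u v w = form (g x) (Gam u x *v v) w -
    1/2 * (form (dd u g x) v w + form (dd v g x) u w - form (dd w g x) u v)" for u v w
  have lin: "dd (a + b) g x = dd a g x + dd b g x" "dd (c *\<^sub>R a) g x = c *\<^sub>R dd a g x" for a b c
    using linear_dd_smooth[OF x smooth_g] by (auto simp: linear_iff)
  have linG: "Gam (a + b) x = Gam a x + Gam b x" "Gam (c *\<^sub>R a) x = c *\<^sub>R Gam a x" for a b c
    using linear_Gam by (auto simp: linear_iff)
  have "F u v w = 0"
  proof (rule trilinear_zero_axis[of F])
    show "linear (\<lambda>u. F u v w)" "linear (\<lambda>v. F u v w)" "linear (F u v)" for u v w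
      by (rule linearI; simp add: F_def form_simps form_add_matrix form_scaleR_matrix lin linG mv_simps algebra_simps)+
    fix i j m
    define c where "c = (\<chi> l. 1/2 * (dd (axis i 1) g x $ j $ l + dd (axis j 1) g x $ i $ l - dd (axis l 1) g x $ i $ j))"
    have "Gam (axis i 1) x $ k $ j = (matrix_inv (g x) *v c) $ k" for k
      by (simp add: Gam_axis christoffel_def partial_g[OF x] c_def matrix_vector_mult_def sum_distrib_left)
    then have "Gam (axis i 1) x *v axis j 1 = matrix_inv (g x) *v c"
      by (simp add: vec_eq_iff matrix_vector_mul_component inner_axis)
    then have "form (g x) (axis m 1) (Gam (axis i 1) x *v axis j 1) = axis m 1 \<bullet> ((g x ** matrix_inv (g x)) *v c)"
      by (simp add: form_def matrix_vector_mul_assoc)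
    also have "\<dots> = c $ m"
      using matrix_inv_inverse[OF pos_def.invertible_form[OF pos_def_g[OF x]]] by (simp add: inner_axis')
    finally show "F (axis i 1) (axis j 1) (axis m 1) = 0"
      by (simp add: F_def form_axis form_sym[OF x] c_def) 
  qed
  then show ?thesis by (simp add: F_def)
qed

lemma torsion_free: "x \<in> U \<Longrightarrow> Gam u x *v v = Gam v x *v u"
proof -
  assume x: "x \<in> U"
  show ?thesis
  proof (rule pos_def.form_eqI[OF pos_def_g[OF x]])
    show "form (g x) (Gam u x *v v) w = form (g x) (Gam v x *v u) w" for w
      using koszul[OF x, of u v w] koszul[OF x, of v u w] dd_g_sym[OF x, of w u v] by simp
  qed
qed

lemma metric_compat:
  "x \<in> U \<Longrightarrow> form (dd u g x) v w = form (g x) (Gam u x *v v) w + form (g x) v (Gam u x *v w)"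
  using koszul[of x u v w] koszul[of x u w v] dd_g_sym[of x u v w]
    form_sym[of x v "Gam u x *v w"] by simp

text \<open>The curvature \<open>dA + A \<and> A\<close> of the connection form \<open>A\<close>,
  evaluated on the constant fields \<open>u\<close> and \<open>v\<close>.\<close>

definition Rm :: "real^'n \<Rightarrow> real^'n \<Rightarrow> real^'n \<Rightarrow> real^'n^'n" where
  "Rm u v x = dd u (Gam v) x - dd v (Gam u) x + Gam u x ** Gam v x - Gam v x ** Gam u x"

lemma Rm_riemann: "x \<in> U \<Longrightarrow> Rm (axis i 1) (axis j 1) x $ l $ k = riemann g l k i j x"
proof -
  assume x: "x \<in> U"
  have "dd v (Gam (axis j 1)) x $ l $ k = dd v (christoffel g l j k) x" for v j
    using dd_linear[OF bounded_linear_compose[OF bounded_linear_vec_nth[of k] bounded_linear_vec_nth[of l]]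
      smooth_differentiable[OF smooth_Gam[of "axis j 1"] x], of v] by (simp add: Gam_axis)
  then show ?thesis
    by (simp add: Rm_def riemann_def partial_eq_dd matrix_matrix_mult_def Gam_axis sum_subtractf)
qed

lemma Rm_swap: "Rm v u x = - Rm u v x"
  by (simp add: Rm_def)

lemma linear_Rm: "x \<in> U \<Longrightarrow> linear (\<lambda>v. Rm u v x)"
  using linear_dd_Gam[of x u] linear_dd_smooth[of x "Gam u", OF _ smooth_Gam] linear_Gam[of x]
  by (auto simp: linear_iff Rm_def mm_simps
      algebra_simps)

lemma ricci_Rm:
  assumes x: "x \<in> U"
  shows "form (ricci g x) v w = (\<Sum>i\<in>UNIV. (Rm (axis i 1) v x *v w) $ i)"
proof -
  define F where "F v w = form (ricci g x) v w - (\<Sum>i\<in>UNIV. (Rm (axis i 1) v x *v w) $ i)" for v w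
  have "F v w = 0"
  proof (rule bilinear_zero_axis[of F])
    show "linear (\<lambda>v. F v w)" "linear (F v)" for v w
      using linear_Rm[OF x]
      by (auto simp: linear_iff F_def form_simps mv_simps sum.distrib sum_distrib_left algebra_simps)
    show "F (axis j 1) (axis k 1) = 0" for j k
      by (simp add: F_def form_axis ricci_def matrix_vector_mul_component inner_axis Rm_riemann[OF x])
  qed
  then show ?thesis by (simp add: F_def)
qed

lemma Rm_mv:
  "x \<in> U \<Longrightarrow> Rm u v x *v w = dd u (\<lambda>y. Gam v y *v w) x - dd v (\<lambda>y. Gam u y *v w) x
    + Gam u x *v (Gam v x *v w) - Gam v x *v (Gam u x *v w)"
  by (simp add: Rm_def mv_simps dd_mv_const smooth_Gam)

text \<open>\<open>Gam q y *v r\<close> is symmetric in \<open>q\<close> and \<open>r\<close> at all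
  \<open>y\<close> near \<open>x\<close>, so the derivative terms cancel in pairs over the cyclic
  sum, and so do the quadratic ones.\<close>

lemma bianchi: "x \<in> U \<Longrightarrow> Rm u v x *v w + Rm v w x *v u + Rm w u x *v v = 0"
proof -
  assume x: "x \<in> U"
  have "dd p (\<lambda>y. Gam q y *v r) x = dd p (\<lambda>y. Gam r y *v q) x" for p q r
    by (rule dd_U_cong[OF x]) (rule torsion_free)
  from this[of u v w] this[of v w u] this[of w u v] show ?thesis
    by (simp add: Rm_mv[OF x] torsion_free[OF x, of v u] torsion_free[OF x, of w v] torsion_free[OF x, of w u])
qed

text \<open>Directions are constant (coordinate) vector fields, so \<open>cov u (cov v E)\<close> is
  \<open>\<nabla>\<^sub>u (\<nabla>\<^sub>v E)\<close> and not the second covariant derivative; since constant fields commute, the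
  commutator is still the curvature.\<close>

definition cov :: "real^'n \<Rightarrow> (real^'n \<Rightarrow> real^'n^'n) \<Rightarrow> real^'n \<Rightarrow> real^'n^'n" where
  "cov v E x = dd v E x + Gam v x ** E x - E x ** Gam v x"

definition cov_vec :: "real^'n \<Rightarrow> (real^'n \<Rightarrow> real^'n) \<Rightarrow> real^'n \<Rightarrow> real^'n" where
  "cov_vec v p x = dd v p x + Gam v x *v p x"

lemma smooth_cov: "smooth_on E U \<Longrightarrow> smooth_on (cov v E) U"
  unfolding cov_def[abs_def] by (intro smooth_intros smooth_Gam)

lemma smooth_cov_vec: "smooth_on p U \<Longrightarrow> smooth_on (cov_vec v p) U"
  unfolding cov_vec_def[abs_def] by (intro smooth_intros smooth_Gam)

lemma linear_cov: "x \<in> U \<Longrightarrow> smooth_on E U \<Longrightarrow> linear (\<lambda>v. cov v E x)"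
  using linear_dd_smooth[of x E] linear_Gam[of x]
  by (auto simp: linear_iff cov_def mm_simps
      algebra_simps)

lemma linear_cov_vec: "x \<in> U \<Longrightarrow> smooth_on p U \<Longrightarrow> linear (\<lambda>v. cov_vec v p x)"
  using linear_dd_smooth[of x p] linear_Gam[of x]
  by (auto simp: linear_iff cov_vec_def mv_simps algebra_simps)

lemma cov_vec_const: "cov_vec v (\<lambda>_. w) x = Gam v x *v w"
  by (simp add: cov_vec_def)

lemma cov_vec_mv: "x \<in> U \<Longrightarrow> smooth_on E U \<Longrightarrow> smooth_on p U \<Longrightarrow>
    cov_vec v (\<lambda>x. E x *v p x) x = cov v E x *v p x + E x *v cov_vec v p x"
  by (simp add: cov_vec_def cov_def dd_mv mv_simps)

lemma cov_mm: "x \<in> U \<Longrightarrow> smooth_on E U \<Longrightarrow> smooth_on F U \<Longrightarrow>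
    cov v (\<lambda>x. E x ** F x) x = cov v E x ** F x + E x ** cov v F x"
  by (simp add: cov_def dd_mm matrix_eq mv_simps)

lemma dd_form_cov: "x \<in> U \<Longrightarrow> smooth_on p U \<Longrightarrow> smooth_on q U \<Longrightarrow>
    dd v (\<lambda>x. form (g x) (p x) (q x)) x = form (g x) (cov_vec v p x) (q x) + form (g x) (p x) (cov_vec v q x)"
  by (simp add: dd_form smooth_g metric_compat cov_vec_def form_simps)

text \<open>The two connection terms form a commutator, which has trace zero.\<close>

lemma trace_cov: "x \<in> U \<Longrightarrow> smooth_on E U \<Longrightarrow> trace (cov v E x) = dd v (\<lambda>x. trace (E x)) x"
  by (simp add: cov_def dd_trace trace_add trace_sub trace_mul_sym[of "Gam v x"])

lemma cov_vec_commute: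
  assumes x: "x \<in> U" and p: "smooth_on p U"
  shows "cov_vec u (cov_vec v p) x - cov_vec v (cov_vec u p) x = Rm u v x *v p x"
proof -
  have "dd a (cov_vec b p) x = dd a (dd b p) x + (Gam b x *v dd a p x + dd a (Gam b) x *v p x)" for a b
    unfolding cov_vec_def[abs_def]
    by (subst dd_plus[OF x]) (auto intro!: smooth_intros smooth_Gam p simp: dd_mv[OF x smooth_Gam p])
  then show ?thesis
    unfolding cov_vec_def[of u] cov_vec_def[of v] cov_vec_def[of _ p]
    by (simp add: Rm_def mv_simps dd_commute[OF open_U p x, of u v])
qed

lemma cov_commute:
  assumes x: "x \<in> U" and E: "smooth_on E U"
  shows "cov u (cov v E) x - cov v (cov u E) x = Rm u v x ** E x - E x ** Rm u v x"
proof -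
  have "dd a (cov b E) x = dd a (dd b E) x + (Gam b x ** dd a E x + dd a (Gam b) x ** E x)
      - (E x ** dd a (Gam b) x + dd a E x ** Gam b x)" for a b
    unfolding cov_def[abs_def]
    by (subst dd_minus[OF x], (intro smooth_intros smooth_Gam E)+, subst dd_plus[OF x],
        (intro smooth_intros smooth_Gam E)+) (simp add: dd_mm[OF x] smooth_Gam E)
  then show ?thesis
    unfolding cov_def[of u] cov_def[of v] cov_def[of _ E]
    by (simp add: Rm_def matrix_eq mv_simps dd_commute[OF open_U E x, of u v])
qed

end

context riem_chart begin

lemma cov_U_cong: "x \<in> U \<Longrightarrow> (\<And>y. y \<in> U \<Longrightarrow> E y = F y) \<Longrightarrow> cov v E x = cov v F x"
  using dd_U_cong[of x E F] by (simp add: cov_def)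

lemma cov_vec_U_cong: "x \<in> U \<Longrightarrow> (\<And>y. y \<in> U \<Longrightarrow> p y = q y) \<Longrightarrow> cov_vec v p x = cov_vec v q x"
  using dd_U_cong[of x p q] by (simp add: cov_vec_def)

lemma cov_zero: "cov v (\<lambda>_. 0) x = 0"
  by (simp add: cov_def matrix_eq mv_simps)

lemma cov_mat: "cov v (\<lambda>_. mat c) x = 0"
proof -
  have "A ** mat c = c *\<^sub>R A" "mat c ** A = c *\<^sub>R A" for A :: "real^'n^'n"
    by (simp_all add: vec_eq_iff matrix_matrix_mult_def mat_def if_distrib[of "\<lambda>u. u * _"]
        if_distrib[of "\<lambda>u. _ * u"] sum.delta sum.delta' mult.commute cong: if_cong)
  then show ?thesis by (simp add: cov_def)
qed

text \<open>As the connection is torsion-free, brackets can be written with covariant derivatives,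
  and only those of \<open>J\<close> survive. This serves in both directions: integrability of
  \<open>J\<close> yields that \<open>J\<close> is parallel, and parallelism of \<open>J'\<close>
  yields that \<open>J'\<close> is integrable.\<close>

lemma nijenhuis_cov:
  assumes x: "x \<in> U" and J: "smooth_on J U" and JJ: "\<And>v. J x *v (J x *v v) = - v"
  shows "nijenhuis J (\<lambda>_. u) (\<lambda>_. v) x = cov (J x *v u) J x *v v - cov (J x *v v) J x *v u
    + J x *v (cov v J x *v u) - J x *v (cov u J x *v v)"
proof -
  have lb: "lie_bracket p q x = dd (p x) q x - dd (q x) p x" for p q :: "real^'n \<Rightarrow> real^'n"
    by (simp add: lie_bracket_def dd_def)
  have lin: "dd (- w) J x = - dd w J x" for w
    using linear_neg[OF linear_dd_smooth[OF x J]] .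
  show ?thesis
    unfolding nijenhuis_def lb cov_def
    by (simp add: dd_mv_const[OF x J] mv_simps lin JJ torsion_free[OF x, of "J x *v v"] 
        torsion_free[OF x, of "J x *v u" v] torsion_free[OF x, of v u])
qed

end


section \<open>Kaehler structures in a chart\<close>

locale almost_kaehler_chart = riem_chart U g for U :: "(real^'n) set" and g +
  fixes J :: "real^'n \<Rightarrow> real^'n^'n"
  assumes smooth_J: "smooth_on J U"
    and JJ: "x \<in> U \<Longrightarrow> J x *v (J x *v v) = - v"
    and orthJ: "x \<in> U \<Longrightarrow> form (g x) (J x *v u) (J x *v v) = form (g x) u v"
    and closed: "x \<in> U \<Longrightarrow> ext_deriv2 (\<lambda>x. \<chi> i j. form (g x) (J x *v axis i 1) (axis j 1)) i j k x = 0"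
begin

lemma skewJ: "x \<in> U \<Longrightarrow> form (g x) (J x *v u) v = - form (g x) u (J x *v v)"
  using orthJ[of x "J x *v u" v] JJ by (simp add: form_simps)

lemma cov_J_skew:
  assumes x: "x \<in> U"
  shows "form (g x) (cov w J x *v u) v = - form (g x) u (cov w J x *v v)"
proof -
  have "dd w (\<lambda>x. form (g x) (J x *v u) v) x = dd w (\<lambda>x. - form (g x) u (J x *v v)) x"
    by (rule dd_U_cong[OF x]) (rule skewJ)
  also have "\<dots> = - dd w (\<lambda>x. form (g x) u (J x *v v)) x"
    by (intro dd_uminus x smooth_intros smooth_g smooth_J)
  finally show ?thesis
    using skewJ[OF x, of u "Gam w x *v v"] skewJ[OF x, of "Gam w x *v u" v]
    by (simp add: dd_form_cov x smooth_intros smooth_J cov_vec_mv cov_vec_const form_simps)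
qed

lemma cov_J_anticommute:
  assumes x: "x \<in> U"
  shows "cov w J x *v (J x *v v) = - (J x *v (cov w J x *v v))"
proof -
  have "cov w (\<lambda>x. J x ** J x) x = cov w (\<lambda>_. mat (-1)) x"
    by (rule cov_U_cong[OF x]) (simp add: matrix_eq mv_simps JJ mat_def, simp add: vec_eq_iff matrix_vector_mult_def if_distrib[of "\<lambda>u. u * _"] sum.delta cong: if_cong)
  then have "(cov w J x ** J x + J x ** cov w J x) *v v = 0"
    by (simp add: cov_mat cov_mm x smooth_J)
  then show ?thesis by (simp add: mv_simps eq_neg_iff_add_eq_0)
qed

text \<open>The exterior derivative is the cyclic sum of covariant derivatives: the connection terms
  cancel because the torsion vanishes.\<close>

lemma closed_cov:
  assumes x: "x \<in> U"
  shows "form (g x) (cov u J x *v v) w + form (g x) (cov v J x *v w) u + form (g x) (cov w J x *v u) v = 0"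
proof -
  define F where "F u v w = form (g x) (cov u J x *v v) w + form (g x) (cov v J x *v w) u
    + form (g x) (cov w J x *v u) v" for u v w
  have lin: "cov (a + b) J x = cov a J x + cov b J x" "cov (c *\<^sub>R a) J x = c *\<^sub>R cov a J x" for a b c
    using linear_cov[OF x smooth_J] by (auto simp: linear_iff)
  have "F u v w = 0"
  proof (rule trilinear_zero_axis[of F])
    show "linear (\<lambda>u. F u v w)" "linear (\<lambda>v. F u v w)" "linear (F u v)" for u v w
      by (rule linearI; simp add: F_def form_simps lin mv_simps algebra_simps)+
    fix i j k
    have d: "dd a (\<lambda>x. form (g x) (J x *v b) c) x =
        form (g x) (cov a J x *v b) c - form (g x) (Gam a x *v b) (J x *v c) + form (g x) (J x *v b) (Gam a x *v c)"
      for a b c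
      using skewJ[OF x, of "Gam a x *v b" c]
      by (simp add: dd_form_cov x smooth_intros smooth_J cov_vec_mv cov_vec_const form_simps)
    show "F (axis i 1) (axis j 1) (axis k 1) = 0"
      using closed[OF x, of i j k] torsion_free[OF x] form_sym[OF x]
      unfolding F_def ext_deriv2_def partial_eq_dd vec_lambda_beta d by (smt (verit))
  qed
  then show ?thesis by (simp add: F_def)
qed

end

locale kaehler_chart = almost_kaehler_chart +
  assumes integrable: "x \<in> U \<Longrightarrow> nijenhuis J (\<lambda>_. axis i 1) (\<lambda>_. axis j 1) x = 0"
begin

lemma nijenhuis_cov_zero:
  assumes x: "x \<in> U"
  shows "cov (J x *v u) J x *v v - cov (J x *v v) J x *v u
    + J x *v (cov v J x *v u) - J x *v (cov u J x *v v) = 0"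
proof -
  have lin: "cov (a + b) J x = cov a J x + cov b J x" "cov (c *\<^sub>R a) J x = c *\<^sub>R cov a J x" for a b c
    using linear_cov[OF x smooth_J] by (auto simp: linear_iff)
  show ?thesis
  proof (rule bilinear_zero_axis[of "\<lambda>u v. cov (J x *v u) J x *v v - cov (J x *v v) J x *v u
    + J x *v (cov v J x *v u) - J x *v (cov u J x *v v)"])
    show "cov (J x *v axis i 1) J x *v axis j 1 - cov (J x *v axis j 1) J x *v axis i 1
      + J x *v (cov (axis j 1) J x *v axis i 1) - J x *v (cov (axis i 1) J x *v axis j 1) = 0" for i j
      using integrable[OF x, of i j] nijenhuis_cov[OF x smooth_J JJ[OF x]] by metis
  qed (rule linearI; simp add: lin mv_simps algebra_simps)+
qed

text \<open>Integrability turns the cyclic identity \<open>cyc\<close> into \<open>J_cyc\<close>, a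
  cyclic sum with one sign reversed. Adding a cyclic shift of \<open>J_cyc\<close> leaves
  \<open>2 t (J u) v w = 0\<close>, and \<open>J\<close> is invertible.\<close>

lemma cov_J:
  assumes x: "x \<in> U"
  shows "cov w J x = 0"
proof -
  define t where "t u v w = form (g x) (cov u J x *v v) w" for u v w
  have skew: "t u v w = - t u w v" for u v w
    using cov_J_skew[OF x, of u v w] form_sym[OF x, of v "cov u J x *v w"] by (simp add: t_def)
  have anti: "t u (J x *v v) w = t u v (J x *v w)" for u v w
    using skewJ[OF x, of "cov u J x *v v" w] by (simp add: t_def cov_J_anticommute[OF x] form_simps)
  have cyc: "t u v w + t v w u + t w u v = 0" for u v w
    using closed_cov[OF x] by (simp add: t_def)
  have nij: "t (J x *v u) v w - t (J x *v v) u w - t v u (J x *v w) + t u v (J x *v w) = 0" for u v w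
  proof -
    have "form (g x) (cov (J x *v u) J x *v v - cov (J x *v v) J x *v u
        + J x *v (cov v J x *v u) - J x *v (cov u J x *v v)) w = 0"
      by (simp add: nijenhuis_cov_zero[OF x] form_simps)
    then show ?thesis by (simp add: t_def form_simps skewJ[OF x])
  qed
  have J_cyc: "t (J x *v u) v w + t (J x *v v) w u - t (J x *v w) u v = 0" for u v w
    using nij[of u v w] skew[of "J x *v v" u w] skew[of v u "J x *v w"] cyc[of u v "J x *v w"] by simp
  have z: "t (J x *v u) v w = 0" for u v w
    using J_cyc[of u v w] J_cyc[of w u v] by simp
  have t0: "t u v w = 0" for u v w
    using z[of "J x *v u" v w] linear_neg[OF linear_cov[OF x smooth_J], of u]
    by (simp add: t_def JJ[OF x] mv_simps form_simps)
  have "cov w J x *v v = 0" for v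
    by (rule pos_def.form_eqI[OF pos_def_g[OF x]]) (use t0 in \<open>simp add: t_def form_simps\<close>)
  then show ?thesis by (simp add: matrix_eq)
qed

lemma Rm_J_commute:
  assumes x: "x \<in> U"
  shows "Rm u v x *v (J x *v w) = J x *v (Rm u v x *v w)"
proof -
  have "cov a (cov b J) x = 0" for a b
    using cov_U_cong[OF x, of "cov b J" "\<lambda>_. 0" a] cov_J by (simp add: cov_zero)
  then have "(Rm u v x ** J x - J x ** Rm u v x) *v w = 0"
    using cov_commute[OF x smooth_J, of u v] by simp
  then show ?thesis by (simp add: mv_simps)
qed

text \<open>The trace of \<open>J R(v,w)\<close> is turned into a Ricci contraction by the first Bianchi identity.\<close>

lemma ricci_form:
  assumes x: "x \<in> U" and E: "ricci g x = k *\<^sub>R g x"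
  shows "trace (J x ** Rm v w x) = 2 * k * form (g x) (J x *v v) w"
proof -
  have *: "(J x *v (Rm v w x *v axis i 1)) $ i =
      (Rm (axis i 1) w x *v (J x *v v)) $ i - (Rm (axis i 1) v x *v (J x *v w)) $ i" for i
  proof -
    have "Rm v w x *v axis i 1 = Rm (axis i 1) w x *v v - Rm (axis i 1) v x *v w"
      using bianchi[OF x, of "axis i 1" v w] Rm_swap[of w "axis i 1" x]
      by (simp add: mv_simps eq_neg_iff_add_eq_0 algebra_simps)
    then have "J x *v (Rm v w x *v axis i 1) = J x *v (Rm (axis i 1) w x *v v) - J x *v (Rm (axis i 1) v x *v w)"
      by (simp add: mv_simps)
    then show ?thesis by (simp add: Rm_J_commute[OF x])
  qed
  have "trace (J x ** Rm v w x) = form (ricci g x) w (J x *v v) - form (ricci g x) v (J x *v w)"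
    by (simp add: trace_eq_sum_mv mv_simps * sum_subtractf ricci_Rm[OF x])
  also have "\<dots> = 2 * k * form (g x) (J x *v v) w"
    using skewJ[OF x, of v w] form_sym[OF x, of w "J x *v v"] by (simp add: E form_scaleR_matrix)
  finally show ?thesis .
qed

end


section \<open>Traces in the quaternion algebra\<close>

lemma trace_scaleR: "trace (c *\<^sub>R A) = c * trace A"
  and trace_uminus: "trace (- A) = - trace A"
  for A :: "real^'n^'n"
  by (simp_all add: trace_def sum_distrib_left sum_negf)

text \<open>Cauchy-Schwarz for the eigenvalues, 4 being the dimension. Diagonalization is avoided:
  in an orthonormal frame \<open>B\<close> is symmetric, so the trace of \<open>B^2\<close> is the
  sum of the squares of all entries and dominates that of the diagonal ones.\<close>

lemma trace_square_symmetric: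
  fixes G H S :: "real^4^4"
  assumes S: "\<And>x y. form G (S *v x) (S *v y) = x \<bullet> y"
    and H: "\<And>u v. form G (H *v u) v = form G u (H *v v)"
  shows "(trace H)\<^sup>2 \<le> 4 * trace (H ** H)"
proof -
  have "x = 0" if "S *v x = 0" for x using S[of x x] that by (simp add: form_simps)
  then obtain T :: "real^4^4" where T: "T ** S = mat 1" using matrix_left_invertible_ker[of S] by blast
  then have T': "S ** T = mat 1" using matrix_left_right_inverse by blast
  have ST: "S *v (T *v v) = v" for v using T' by (simp add: matrix_vector_mul_assoc)
  define B where "B = T ** (H ** S)"
  have "trace B = trace ((H ** S) ** T)" unfolding B_def by (rule trace_mul_sym)
  also have "(H ** S) ** T = H" by (simp add: matrix_eq mv_simps ST)
  finally have tB: "trace B = trace H" .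
  have "trace (B ** B) = trace ((H ** S ** T) ** (H ** S ** T))"
    using trace_mul_sym[of T "H ** S ** T ** H ** S"] by (simp add: B_def matrix_mul_assoc)
  also have "H ** S ** T = H" by (simp add: matrix_eq mv_simps ST)
  finally have tBB: "trace (B ** B) = trace (H ** H)" .
  have "(B *v x) \<bullet> y = x \<bullet> (B *v y)" for x y
    unfolding S[symmetric] by (simp add: B_def mv_simps ST H)
  from this[of "axis _ 1" "axis _ 1"] have sym: "B $ j $ i = B $ i $ j" for i j
    by (simp add: inner_axis inner_axis' matrix_vector_mul_component)
  have "(trace B)\<^sup>2 \<le> 4 * (B$1$1 * B$1$1 + B$2$2 * B$2$2 + B$3$3 * B$3$3 + B$4$4 * B$4$4)"
  proof -
    have "0 \<le> (B$1$1 - B$2$2)\<^sup>2 + (B$1$1 - B$3$3)\<^sup>2 + (B$1$1 - B$4$4)\<^sup>2 + (B$2$2 - B$3$3)\<^sup>2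
        + (B$2$2 - B$4$4)\<^sup>2 + (B$3$3 - B$4$4)\<^sup>2" by (intro add_nonneg_nonneg) auto
    then show ?thesis by (simp add: trace_def sum_4 power2_eq_square algebra_simps)
  qed
  also have "B$1$1 * B$1$1 + B$2$2 * B$2$2 + B$3$3 * B$3$3 + B$4$4 * B$4$4 \<le> trace (B ** B)"
  proof -
    have "trace (B ** B) = (\<Sum>i\<in>UNIV. \<Sum>j\<in>UNIV. B $ i $ j * B $ i $ j)"
      by (simp add: trace_def matrix_matrix_mult_def sym)
    also have "\<dots> \<ge> (\<Sum>i\<in>UNIV. B $ i $ i * B $ i $ i)"
      by (intro sum_mono member_le_sum) auto
    finally show ?thesis by (simp add: sum_4)
  qed
  finally show ?thesis unfolding tB tBB by simp
qed

context acs_pair begin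

lemma tr_J'L: "trace (J' ** L) = 0" "trace (L ** J') = 0"
proof -
  have "J' ** L = M" "L ** J' = - M" by (simp_all add: matrix_eq mv_simps J'L LJ')
  then show "trace (J' ** L) = 0" "trace (L ** J') = 0"
    using trace_mul_sym[of J' L] by (simp_all add: trace_uminus)
qed

lemma tr_JJ: "trace (J ** J) = - 4" "trace (J' ** J') = - 4"
proof -
  have "J ** J = - mat 1" "J' ** J' = - mat 1" by (simp_all add: matrix_eq mv_simps JJ J'J')
  then show "trace (J ** J) = - 4" "trace (J' ** J') = - 4"
    by (simp_all add: trace_scaleR trace_uminus trace_I)
qed

lemma anticomm_matrix: "J ** J' + J' ** J = - (2 * f) *\<^sub>R mat 1"
  using anticomm by (simp add: matrix_eq mv_simps)

lemma tr_JJ': "trace (J ** J') = - 4 * f" "trace (J' ** J) = - 4 * f"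
proof -
  have "trace (J ** J' + J' ** J) = - (2 * f) * 4"
    unfolding anticomm_matrix by (simp add: trace_scaleR trace_uminus trace_I)
  then show "trace (J ** J') = - 4 * f" "trace (J' ** J) = - 4 * f"
    using trace_mul_sym[of J J'] by (simp_all add: trace_add)
qed

lemma tr_L: "trace L = 0"
  by (simp add: L_def trace_add trace_scaleR trace_uminus tr_JJ' trace_I)

lemma LL_matrix: "L ** L = - (1 - f\<^sup>2) *\<^sub>R mat 1"
  by (simp only: matrix_eq mv_simps LL matrix_vector_mul_lid) simp

lemma tr_LL: "trace (L ** L) = - 4 * (1 - f\<^sup>2)"
  unfolding LL_matrix by (simp add: trace_scaleR trace_uminus trace_I)

lemma tr_LM: "trace (L ** M) = 0" "trace (M ** L) = 0"
proof -
  have "L *v (M *v v) = - (M *v (L *v v))" for v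
    using LJ'[of "L *v v"] by (simp only: J'L)
  then have "L ** M = - (M ** L)" by (simp add: matrix_eq mv_simps)
  then show "trace (L ** M) = 0" "trace (M ** L) = 0"
    using trace_mul_sym[of L M] by (simp_all add: trace_scaleR trace_uminus)
qed

lemma tr_J'M: "trace (J' ** M) = 0"
  by (simp add: M_def mm_simps trace_sub trace_scaleR trace_uminus tr_JJ' tr_JJ)

lemma tr_JM: "trace (J ** M) = - 4 * (1 - f\<^sup>2)"
  by (simp add: M_def mm_simps trace_sub trace_scaleR trace_uminus tr_JJ' tr_JJ power2_eq_square algebra_simps)

lemma tr_LJL: "trace (L ** (J ** L)) = 0"
proof -
  have "J ** (L ** L) = - (L ** (J ** L))" by (simp add: matrix_eq mv_simps JL)
  moreover have "trace (L ** (J ** L)) = trace ((J ** L) ** L)" by (rule trace_mul_sym)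
  ultimately show ?thesis by (simp add: matrix_mul_assoc[symmetric] trace_scaleR trace_uminus)
qed

lemma tr_LJM: "trace (L ** (J ** M)) = 4 * (1 - f\<^sup>2) * f"
proof -
  have "trace (L ** (J ** M)) = trace ((J ** M) ** L)" by (rule trace_mul_sym)
  also have "(J ** M) ** L = - (1 - f\<^sup>2) *\<^sub>R (J ** J')"
    unfolding matrix_eq mv_simps J'L[symmetric] LL by simp
  finally show ?thesis by (simp add: trace_scaleR trace_uminus tr_JJ' trace_sub algebra_simps)
qed

text \<open>If \<open>R\<close> commutes with \<open>J\<close>, then \<open>R\<close> is trace-orthogonal to the part of \<open>J'\<close> anticommuting with \<open>J\<close>.\<close>

lemma trace_curvature:
  assumes R: "R ** J = J ** R"
  shows "trace (L ** (R ** J' - J' ** R)) = 2 * (1 - f\<^sup>2) * trace (J ** R)"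
proof -
  have LJ'm: "L ** J' = - M" and J'Lm: "J' ** L = M" by (simp_all add: matrix_eq mv_simps LJ' J'L)
  have "trace (L ** (R ** J' - J' ** R)) = trace (L ** R ** J') - trace (L ** J' ** R)"
    by (simp add: mm_simps trace_sub matrix_mul_assoc)
  also have "trace (L ** R ** J') = trace (J' ** L ** R)"
    using trace_mul_sym[of "L ** R" J'] by (simp add: matrix_mul_assoc)
  finally have 1: "trace (L ** (R ** J' - J' ** R)) = 2 * (trace (J ** R) - f * trace (J' ** R))"
    by (simp add: LJ'm J'Lm mm_simps trace_scaleR trace_uminus) (simp add: M_def mm_simps trace_sub trace_scaleR trace_uminus)
  have "trace ((J ** J' + J' ** J) ** (J ** R)) = - (2 * f) * trace (J ** R)"
    unfolding anticomm_matrix by (simp add: mm_simps trace_scaleR trace_uminus)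
  moreover have "trace (J ** J' ** (J ** R)) = trace (J' ** (J ** R) ** J)"
    using trace_mul_sym[of J "J' ** (J ** R)"] by (simp add: matrix_mul_assoc)
  moreover have "J' ** (J ** R) ** J = - (J' ** R)"
  proof -
    have "R *v (J *v v) = J *v (R *v v)" for v using R by (metis matrix_vector_mul_assoc)
    then show ?thesis by (simp add: matrix_eq mv_simps JJ)
  qed
  moreover have "J' ** J ** (J ** R) = - (J' ** R)" by (simp add: matrix_eq mv_simps JJ)
  ultimately have "trace (J' ** R) = f * trace (J ** R)"
    by (simp add: mm_simps trace_add trace_sub trace_scaleR trace_uminus)
  with 1 show ?thesis by (simp add: power2_eq_square algebra_simps)
qed

text \<open>Against \<open>J'\<close> the first two terms contribute \<open>- 2 tr H\<close> and
  \<open>M\<close> contributes nothing. Against \<open>J\<close> they contribute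
  \<open>- 2 f tr H\<close>, through the anticommutator of \<open>J\<close> and \<open>J'\<close>;
  inserting the value of \<open>tr H\<close> leaves an equation for \<open>c\<close>.\<close>

lemma trace_hessian:
  assumes H: "J' ** H + H ** J' + c *\<^sub>R M = - k *\<^sub>R J"
  shows "trace H = - 2 * k * f" and "(1 - f\<^sup>2) * (c + k) = 0"
proof -
  have "trace (J' ** (J' ** H + H ** J' + c *\<^sub>R M)) = - k * trace (J' ** J)"
    unfolding H by (simp add: mm_simps trace_scaleR trace_uminus)
  moreover have "trace (J' ** (H ** J')) = trace (J' ** (J' ** H))"
    using trace_mul_sym[of "J' ** H" J'] by (simp add: matrix_mul_assoc)
  moreover have "J' ** (J' ** H) = - H" by (simp add: matrix_eq mv_simps J'J')
  ultimately show tr: "trace H = - 2 * k * f"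
    by (simp add: mm_simps trace_add trace_sub trace_scaleR trace_uminus tr_J'M tr_JJ' algebra_simps)
  have "trace (J ** (J' ** H + H ** J' + c *\<^sub>R M)) = - k * trace (J ** J)"
    unfolding H by (simp add: mm_simps trace_scaleR trace_uminus)
  moreover have "trace (J ** (H ** J')) = trace (J' ** J ** H)"
    using trace_mul_sym[of "J ** H" J'] by (simp add: matrix_mul_assoc)
  moreover have "trace (J ** (J' ** H)) + trace (J' ** J ** H) = - (2 * f) * trace H"
  proof -
    have "trace ((J ** J' + J' ** J) ** H) = - (2 * f) * trace H"
      unfolding anticomm_matrix by (simp add: mm_simps trace_scaleR trace_uminus)
    then show ?thesis by (simp add: mm_simps trace_add matrix_mul_assoc)
  qed
  ultimately show "(1 - f\<^sup>2) * (c + k) = 0"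
    unfolding tr by (simp add: mm_simps trace_add trace_sub trace_scaleR trace_uminus tr_JM tr_JJ power2_eq_square algebra_simps)
qed

end


section \<open>The region where the two structures are independent\<close>

context riem_chart begin

lemma cov_plus: "x \<in> U \<Longrightarrow> smooth_on E U \<Longrightarrow> smooth_on F U \<Longrightarrow>
    cov v (\<lambda>x. E x + F x) x = cov v E x + cov v F x"
  by (simp add: cov_def dd_plus mm_simps)

lemma cov_diff: "x \<in> U \<Longrightarrow> smooth_on E U \<Longrightarrow> smooth_on F U \<Longrightarrow>
    cov v (\<lambda>x. E x - F x) x = cov v E x - cov v F x"
  by (simp add: cov_def dd_minus mm_simps)

lemma cov_scaleR: "x \<in> U \<Longrightarrow> smooth_on a U \<Longrightarrow> smooth_on E U \<Longrightarrow>
    cov v (\<lambda>x. a x *\<^sub>R E x) x = a x *\<^sub>R cov v E x + dd v a x *\<^sub>R E x"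
  by (simp add: cov_def dd_scaleR mm_simps algebra_simps)

end

locale kaehler_pair = kaehler_chart U g J + K': almost_kaehler_chart U g J'
  for U :: "(real^4) set" and g J J' +
  fixes k :: real
  assumes anticomm: "x \<in> U \<Longrightarrow> \<exists>f. \<forall>v. J x *v (J' x *v v) + J' x *v (J x *v v) = - (2 * f) *\<^sub>R v"
    and einstein: "x \<in> U \<Longrightarrow> ricci g x = k *\<^sub>R g x"
begin

text \<open>A trace instead of a choice from \<open>anticomm\<close>, so that smoothness in
  \<open>x\<close> is evident; the factor comes from \<open>tr (J J') = - 4 f\<close>.\<close>

definition f :: "real^4 \<Rightarrow> real" where
  "f x = - (1/4) * trace (J x ** J' x)"

lemma smooth_f: "smooth_on f U"
  unfolding f_def[abs_def] by (intro smooth_intros smooth_J K'.smooth_J)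

lemma acs_pair: "x \<in> U \<Longrightarrow> acs_pair (g x) (J x) (J' x) (f x)"
proof -
  assume x: "x \<in> U"
  then obtain c where c: "\<And>v. J x *v (J' x *v v) + J' x *v (J x *v v) = - (2 * c) *\<^sub>R v"
    using anticomm by blast
  interpret pos_def "g x" using pos_def_g[OF x] .
  have "acs_pair (g x) (J x) (J' x) c"
    by unfold_locales (use c JJ[OF x] K'.JJ[OF x] orthJ[OF x] K'.orthJ[OF x] in auto)
  then show ?thesis using acs_pair.tr_JJ'(1)[of "g x" "J x" "J' x" c] by (simp add: f_def)
qed

end

text \<open>Below, \<open>n\<close> is the gradient of \<open>artanh f\<close> and \<open>H\<close> its covariant derivative.\<close>

locale kaehler_pair_generic = kaehler_pair +
  assumes f_lt: "x \<in> U \<Longrightarrow> (f x)\<^sup>2 < 1"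
begin

definition "M x = acs_pair.M (J x) (J' x) (f x)"
definition "L x = acs_pair.L (J x) (J' x) (f x)"

lemma acs_pair_generic: "x \<in> U \<Longrightarrow> acs_pair_generic (g x) (J x) (J' x) (f x)"
  by (simp add: acs_pair_generic.intro acs_pair_generic_axioms_def acs_pair f_lt)

lemma M_eq: "x \<in> U \<Longrightarrow> M x = J x - f x *\<^sub>R J' x"
  unfolding M_def by (rule acs_pair.M_def[OF acs_pair])

lemma L_eq: "x \<in> U \<Longrightarrow> L x = J x ** J' x + f x *\<^sub>R mat 1"
  unfolding L_def by (rule acs_pair.L_def[OF acs_pair])

lemma smooth_M: "smooth_on M U"
proof -
  have "smooth_on (\<lambda>x. J x - f x *\<^sub>R J' x) U"
    by (intro smooth_intros smooth_J K'.smooth_J smooth_f)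
  then show ?thesis by (rule smooth_on_cong[OF open_U, THEN iffD1, rotated]) (simp add: M_eq)
qed

lemma smooth_L: "smooth_on L U"
proof -
  have "smooth_on (\<lambda>x. J x ** J' x + f x *\<^sub>R mat 1) U"
    by (intro smooth_intros smooth_J K'.smooth_J smooth_f)
  then show ?thesis by (rule smooth_on_cong[OF open_U, THEN iffD1, rotated]) (simp add: L_eq)
qed

definition n :: "real^4 \<Rightarrow> real^4" where
  "n x = inverse (1 - (f x)\<^sup>2) *\<^sub>R (matrix_inv (g x) *v (\<chi> i. dd (axis i 1) f x))"

lemma smooth_n: "smooth_on n U"
proof -
  have "1 - (f x)\<^sup>2 \<noteq> 0" if "x \<in> U" for x using f_lt[OF that] by simp
  moreover have "smooth_on (\<lambda>x. \<chi> i. dd (axis i 1) f x) U"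
    by (rule smooth_on_vec[OF open_U]) (simp add: smooth_on_dd smooth_f)
  ultimately show ?thesis
    unfolding n_def[abs_def] power2_eq_square
    by (intro smooth_intros smooth_on_inverse[OF open_U] smooth_f smooth_on_matrix_inv[OF open_U smooth_g]
        pos_def.invertible_form[OF pos_def_g])
qed

lemma form_n:
  assumes x: "x \<in> U"
  shows "(1 - (f x)\<^sup>2) * form (g x) (n x) v = dd v f x"
proof -
  define F where "F v = (1 - (f x)\<^sup>2) * form (g x) (n x) v - dd v f x" for v
  have "F v = 0"
  proof (rule linear_zero_axis[of F])
    show "linear F"
      using linear_dd_smooth[OF x smooth_f] by (auto simp: linear_iff F_def form_simps algebra_simps)
    fix i
    have "form (g x) (axis i 1) (n x) = inverse (1 - (f x)\<^sup>2) *
        (axis i 1 \<bullet> ((g x ** matrix_inv (g x)) *v (\<chi> i. dd (axis i 1) f x)))"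
      by (simp add: n_def form_def mv_simps)
    also have "\<dots> = inverse (1 - (f x)\<^sup>2) * dd (axis i 1) f x"
      using matrix_inv_inverse[OF pos_def.invertible_form[OF pos_def_g[OF x]]] by (simp add: inner_axis')
    finally show "F (axis i 1) = 0"
      using f_lt[OF x] by (simp add: F_def form_sym[OF x, of "n x"] field_simps)
  qed
  then show ?thesis by (simp add: F_def)
qed

text \<open>Differentiating \<open>J'^2 = - 1\<close>, the skewness of \<open>J'\<close> and, as
  \<open>J\<close> is parallel, \<open>J J' + J' J = - 2 f\<close> brings \<open>cov w J' x\<close>
  into the scope of \<open>skew_anticommuting_decomp\<close> with \<open>c = dd w f x\<close>. The
  coefficient of \<open>L\<close> that remains free is fixed by closedness.\<close>

lemma cov_J':
  assumes x: "x \<in> U"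
  shows "cov w J' x = form (g x) (n x) w *\<^sub>R M x + form (g x) (J' x *v n x) w *\<^sub>R L x"
proof -
  interpret P: acs_pair_generic "g x" "J x" "J' x" "f x" by (rule acs_pair_generic[OF x])
  have comm: "J x *v (cov w J' x *v v) + cov w J' x *v (J x *v v) = - (2 * dd w f x) *\<^sub>R v" for w v
  proof -
    have "cov w (\<lambda>x. J x ** J' x + J' x ** J x) x = cov w (\<lambda>x. (- 2 * f x) *\<^sub>R mat 1) x"
    proof (rule cov_U_cong[OF x])
      fix y assume "y \<in> U"
      show "J y ** J' y + J' y ** J y = (- 2 * f y) *\<^sub>R mat 1"
        using acs_pair.anticomm_matrix[OF acs_pair[OF \<open>y \<in> U\<close>]] by simp
    qed
    also have "\<dots> = (- 2 * f x) *\<^sub>R cov w (\<lambda>_. mat 1) x + dd w (\<lambda>x. - 2 * f x) x *\<^sub>R mat 1"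
      by (intro cov_scaleR x smooth_intros smooth_f)
    also have "\<dots> = (- 2 * dd w f x) *\<^sub>R mat 1"
      using dd_mult[OF x smooth_on_const smooth_f, of w "- 2"] by (simp add: cov_mat)
    finally have "(J x ** cov w J' x + cov w J' x ** J x) *v v = ((- 2 * dd w f x) *\<^sub>R mat 1) *v v"
      by (simp add: cov_plus[OF x] cov_mm[OF x] smooth_intros smooth_J K'.smooth_J cov_J[OF x])
    then show ?thesis by (simp add: mv_simps)
  qed
  have "\<exists>b. \<forall>v. cov w J' x *v v = (dd w f x / (1 - (f x)\<^sup>2)) *\<^sub>R (P.M *v v) + b *\<^sub>R (P.L *v v)" for w
    using P.skew_anticommuting_decomp[OF K'.cov_J_skew[OF x] K'.cov_J_anticommute[OF x] comm] by metis
  then obtain b where b: "\<And>w v. cov w J' x *v v = (dd w f x / (1 - (f x)\<^sup>2)) *\<^sub>R (P.M *v v) + b w *\<^sub>R (P.L *v v)"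
    by metis
  have a: "dd w f x / (1 - (f x)\<^sup>2) = form (g x) (n x) w" for w
    using form_n[OF x, of w] f_lt[OF x] by (simp add: field_simps)
  have cyc: "form (g x) (n x) X * form (g x) (P.M *v Y) Z + b X * form (g x) (P.L *v Y) Z
      + (form (g x) (n x) Y * form (g x) (P.M *v Z) X + b Y * form (g x) (P.L *v Z) X)
      + (form (g x) (n x) Z * form (g x) (P.M *v X) Y + b Z * form (g x) (P.L *v X) Y) = 0" for X Y Z
    using K'.closed_cov[OF x, of X Y Z] by (simp add: b a form_simps)
  have "cov w J' x *v v = (form (g x) (n x) w *\<^sub>R M x + form (g x) (J' x *v n x) w *\<^sub>R L x) *v v" for v
  proof (cases "w = 0")
    case True
    then show ?thesis
      using linear_0[OF linear_cov[OF x K'.smooth_J]] by (simp add: form_simps)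
  next
    case False
    then have "b w = form (g x) (J' x *v n x) w"
      using P.closed_imp_conjugate[OF cyc] P.skewJ' by simp
    then show ?thesis by (simp add: b a M_def L_def mv_simps)
  qed
  then show ?thesis by (simp add: matrix_eq)
qed

lemma dd_f: "x \<in> U \<Longrightarrow> dd v f x = (1 - (f x)\<^sup>2) * form (g x) (n x) v"
  using form_n by simp

lemma smooth_J'n: "smooth_on (\<lambda>x. J' x *v n x) U"
  by (intro smooth_intros smooth_n K'.smooth_J)

text \<open>On the part of \<open>\<Lambda>\<^sup>+\<close> orthogonal to \<open>\<omega>\<^sub>J\<close> the curvature is that of the canonical bundle, a multiple of
  \<open>\<omega>\<^sub>J\<close> by the Einstein condition; pairing \<open>[R(u,v), J']\<close> with \<open>L\<close> isolates it.\<close>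

lemma dd_conjugate_form:
  assumes x: "x \<in> U"
  shows "dd u (\<lambda>x. form (g x) (J' x *v n x) v) x - dd v (\<lambda>x. form (g x) (J' x *v n x) u) x
    = - k * form (g x) (J x *v u) v"
proof -
  interpret P: acs_pair_generic "g x" "J x" "J' x" "f x" by (rule acs_pair_generic[OF x])
  define \<alpha> where "\<alpha> v x = form (g x) (n x) v" for v x
  define \<beta> where "\<beta> v x = form (g x) (J' x *v n x) v" for v x
  define D where "D = 1 - (f x)\<^sup>2"
  have D: "D \<noteq> 0" using f_lt[OF x] by (simp add: D_def)
  have sm: "smooth_on (\<alpha> v) U" "smooth_on (\<beta> v) U" for v
    unfolding \<alpha>_def \<beta>_def by (intro smooth_intros smooth_g smooth_n smooth_J'n)+
  have cJ': "cov w J' x = \<alpha> w x *\<^sub>R P.M + \<beta> w x *\<^sub>R P.L" for w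
    using cov_J'[OF x] by (simp add: \<alpha>_def \<beta>_def M_def L_def)
  have cM: "cov w M x = - f x *\<^sub>R cov w J' x - (D * \<alpha> w x) *\<^sub>R J' x" for w
  proof -
    have "cov w M x = cov w (\<lambda>x. J x - f x *\<^sub>R J' x) x" by (rule cov_U_cong[OF x]) (rule M_eq)
    also have "\<dots> = - f x *\<^sub>R cov w J' x - (D * \<alpha> w x) *\<^sub>R J' x"
      by (simp add: cov_diff[OF x] cov_scaleR[OF x] smooth_intros smooth_J K'.smooth_J smooth_f cov_J[OF x]
          dd_f[OF x] D_def \<alpha>_def)
    finally show ?thesis .
  qed
  have cL: "cov w L x = J x ** cov w J' x + (D * \<alpha> w x) *\<^sub>R mat 1" for w
  proof -
    have "cov w L x = cov w (\<lambda>x. J x ** J' x + f x *\<^sub>R mat 1) x" by (rule cov_U_cong[OF x]) (rule L_eq)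
    also have "\<dots> = J x ** cov w J' x + (D * \<alpha> w x) *\<^sub>R mat 1"
      by (simp add: cov_plus[OF x] cov_mm[OF x] cov_scaleR[OF x] smooth_intros smooth_J K'.smooth_J smooth_f
          cov_J[OF x] cov_mat dd_f[OF x] D_def \<alpha>_def)
    finally show ?thesis .
  qed
  have tM: "trace (P.L ** cov w M x) = 4 * f x * D * \<beta> w x" for w
    by (simp add: cM cJ' mm_simps trace_sub trace_add trace_scaleR trace_uminus P.tr_LL P.tr_LM P.tr_J'L D_def algebra_simps)
  have tL: "trace (P.L ** cov w L x) = 4 * f x * D * \<alpha> w x" for w
    by (simp add: cL cJ' mm_simps trace_sub trace_add trace_scaleR trace_uminus P.tr_LJL P.tr_LJM P.tr_L D_def algebra_simps)
  \<comment> \<open>The products of \<alpha> and \<beta> are symmetric in \<open>u\<close> and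
    \<open>v\<close> and drop out of the commutator, which leaves the exterior derivative of
    \<beta>, the one-form dual to \<open>J' n\<close>.\<close>
  have tcc: "trace (P.L ** cov u (cov v J') x) =
      4 * f x * D * (\<alpha> v x * \<beta> u x + \<beta> v x * \<alpha> u x) - 4 * D * dd u (\<beta> v) x" for u v
  proof -
    have "cov u (cov v J') x = cov u (\<lambda>x. \<alpha> v x *\<^sub>R M x + \<beta> v x *\<^sub>R L x) x"
      by (rule cov_U_cong[OF x]) (simp add: cov_J' \<alpha>_def \<beta>_def)
    also have "\<dots> = (\<alpha> v x *\<^sub>R cov u M x + dd u (\<alpha> v) x *\<^sub>R M x) + (\<beta> v x *\<^sub>R cov u L x + dd u (\<beta> v) x *\<^sub>R L x)"
      by (simp add: cov_plus[OF x] cov_scaleR[OF x] smooth_intros sm smooth_M smooth_L)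
    finally show ?thesis
      by (simp add: M_def L_def mm_simps trace_add trace_scaleR trace_uminus tM tL P.tr_LL P.tr_LM D_def[symmetric] algebra_simps)
  qed
  have "trace (P.L ** (cov u (cov v J') x - cov v (cov u J') x)) = 2 * D * trace (J x ** Rm u v x)"
  proof -
    have "Rm u v x ** J x = J x ** Rm u v x" by (simp add: matrix_eq mv_simps Rm_J_commute[OF x])
    from P.trace_curvature[OF this] show ?thesis
      by (simp add: cov_commute[OF x K'.smooth_J] D_def)
  qed
  then have "- 4 * D * (dd u (\<beta> v) x - dd v (\<beta> u) x) = 4 * D * (k * form (g x) (J x *v u) v)"
    by (simp add: mm_simps trace_sub tcc ricci_form[OF x einstein[OF x]] algebra_simps)
  then have "D * (dd u (\<beta> v) x - dd v (\<beta> u) x + k * form (g x) (J x *v u) v) = 0"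
    by (simp add: algebra_simps)
  then have "dd u (\<beta> v) x - dd v (\<beta> u) x + k * form (g x) (J x *v u) v = 0"
    using D by simp
  then show ?thesis by (simp add: \<beta>_def[abs_def])
qed

text \<open>The Hessian of \<open>artanh f\<close> is symmetric. The function itself is avoided:
  second derivatives of \<open>f\<close> commute, and differentiating the factor
  \<open>1 - f^2\<close> only adds a multiple of the symmetric product of \<open>g(n, u)\<close> and
  \<open>g(n, v)\<close>.\<close>

lemma cov_n_sym:
  assumes x: "x \<in> U"
  shows "form (g x) (cov_vec u n x) v = form (g x) u (cov_vec v n x)"
proof -
  have "dd u (\<lambda>x. dd v f x) x = dd u (\<lambda>x. (1 - f x * f x) * form (g x) (n x) v) x" for u v
    by (rule dd_U_cong[OF x]) (simp add: dd_f power2_eq_square)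
  also have "dd u (\<lambda>x. (1 - f x * f x) * form (g x) (n x) v) x =
      (1 - f x * f x) * (form (g x) (cov_vec u n x) v + form (g x) (n x) (Gam u x *v v))
      - 2 * f x * (1 - (f x)\<^sup>2) * form (g x) (n x) u * form (g x) (n x) v" for u v
    by (simp add: dd_mult[OF x] dd_minus[OF x] smooth_intros smooth_f smooth_g smooth_n dd_form_cov[OF x]
        cov_vec_const dd_f[OF x])
  finally have *: "dd u (dd v f) x = (1 - f x * f x) * (form (g x) (cov_vec u n x) v + form (g x) (n x) (Gam u x *v v))
      - 2 * f x * (1 - (f x)\<^sup>2) * form (g x) (n x) u * form (g x) (n x) v" for u v .
  have "(1 - f x * f x) * form (g x) (cov_vec u n x) v = (1 - f x * f x) * form (g x) (cov_vec v n x) u"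
    using dd_commute[OF open_U smooth_f x, of u v] *[of u v] *[of v u] torsion_free[OF x, of u v]
    by (simp add: algebra_simps)
  moreover have "1 - f x * f x \<noteq> 0" using f_lt[OF x] by (simp add: power2_eq_square)
  ultimately show ?thesis using form_sym[OF x, of u] by simp
qed

definition H :: "real^4 \<Rightarrow> real^4^4" where
  "H x = (\<chi> i j. cov_vec (axis j 1) n x $ i)"

lemma H_mv:
  assumes x: "x \<in> U"
  shows "H x *v v = cov_vec v n x"
proof -
  have "H x *v v - cov_vec v n x = 0"
  proof (rule linear_zero_axis[of "\<lambda>v. H x *v v - cov_vec v n x"])
    show "linear (\<lambda>v. H x *v v - cov_vec v n x)"
      using linear_cov_vec[OF x smooth_n] by (intro linear_compose_sub) auto
    show "H x *v axis i 1 - cov_vec (axis i 1) n x = 0" for i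
      by (simp add: H_def vec_eq_iff matrix_vector_mul_component inner_axis)
  qed
  then show ?thesis by simp
qed

lemma smooth_H: "smooth_on H U"
proof (intro smooth_on_vec[OF open_U])
  fix i j
  show "smooth_on (\<lambda>x. H x $ i $ j) U"
    using smooth_on_vec_nth[OF open_U smooth_cov_vec[OF smooth_n]] by (simp add: H_def)
qed

text \<open>Expands \<open>dd_conjugate_form\<close> by the product rule for \<open>J' n\<close>.
  The terms with a derivative of \<open>J'\<close> combine, by closedness with \<open>n\<close> as
  third argument, into the derivative of \<open>J'\<close> along \<open>n\<close>; this is
  \<open>g(n, n) M\<close> because \<open>g(J' n, n) = 0\<close>. The other terms give
  \<open>J' H + H J'\<close> by symmetry of \<open>H\<close>.\<close>

lemma hessian_eq:
  assumes x: "x \<in> U"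
  shows "J' x ** H x + H x ** J' x + form (g x) (n x) (n x) *\<^sub>R M x = - k *\<^sub>R J x"
proof -
  interpret P: acs_pair_generic "g x" "J x" "J' x" "f x" by (rule acs_pair_generic[OF x])
  let ?\<alpha> = "\<lambda>v. form (g x) (n x) v" and ?\<beta> = "\<lambda>v. form (g x) (J' x *v n x) v"
  have d: "dd u (\<lambda>x. form (g x) (J' x *v n x) v) x =
      ?\<alpha> u * form (g x) (P.M *v n x) v + ?\<beta> u * form (g x) (P.L *v n x) v
      + form (g x) (J' x *v (H x *v u)) v + form (g x) (J' x *v n x) (Gam u x *v v)" for u v
    by (simp add: dd_form_cov[OF x] smooth_J'n cov_vec_mv[OF x] K'.smooth_J smooth_n cov_vec_const cov_J'[OF x]
        H_mv[OF x] mv_simps form_simps M_def L_def)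
  have "form (g x) ((J' x ** H x + H x ** J' x + ?\<alpha> (n x) *\<^sub>R M x) *v u) v = form (g x) ((- k *\<^sub>R J x) *v u) v" for u v
  proof -
    have \<beta>n: "?\<beta> (n x) = 0"
      using P.skewJ'[of "n x" "n x"] P.sym[of "J' x *v n x" "n x"] by simp
    have "?\<alpha> u * form (g x) (P.M *v v) (n x) + ?\<beta> u * form (g x) (P.L *v v) (n x)
        + (?\<alpha> v * form (g x) (P.M *v n x) u + ?\<beta> v * form (g x) (P.L *v n x) u)
        + ?\<alpha> (n x) * form (g x) (P.M *v u) v = 0"
      using K'.closed_cov[OF x, of u v "n x"] \<beta>n
      by (simp add: cov_J'[OF x] mv_simps form_simps M_def L_def)
    moreover have "form (g x) (P.M *v v) (n x) = - form (g x) (P.M *v n x) v"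
      "form (g x) (P.L *v v) (n x) = - form (g x) (P.L *v n x) v"
      using P.skewM P.skewL P.sym by metis+
    moreover have "form (g x) (J' x *v (H x *v v)) u = - form (g x) (H x *v (J' x *v u)) v"
      using P.skewJ'[of "H x *v v" u] cov_n_sym[OF x, of v "J' x *v u"] P.sym[of v]
      by (simp add: H_mv[OF x])
    ultimately show ?thesis
      using dd_conjugate_form[OF x, of u v] torsion_free[OF x, of u v]
      by (simp add: d mv_simps form_simps M_def)
  qed
  then have "(J' x ** H x + H x ** J' x + ?\<alpha> (n x) *\<^sub>R M x) *v u = (- k *\<^sub>R J x) *v u" for u
    using P.form_eqI by blast
  then show ?thesis by (simp add: matrix_eq)
qed

lemma norm_n: "x \<in> U \<Longrightarrow> form (g x) (n x) (n x) = - k"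
  and trace_H: "x \<in> U \<Longrightarrow> trace (H x) = - 2 * k * f x"
proof -
  assume x: "x \<in> U"
  interpret P: acs_pair_generic "g x" "J x" "J' x" "f x" by (rule acs_pair_generic[OF x])
  note * = P.trace_hessian[OF hessian_eq[OF x, unfolded M_def]]
  show "trace (H x) = - 2 * k * f x" by (rule *)
  show "form (g x) (n x) (n x) = - k" using *(2) f_lt[OF x] by auto
qed

text \<open>Differentiating the constant \<open>g(n, n)\<close> along \<open>w\<close> gives
  \<open>g(H w, n) = 0\<close>, and \<open>H\<close> is symmetric.\<close>

lemma H_n: "x \<in> U \<Longrightarrow> H x *v n x = 0"
proof (rule pos_def.form_eqI[OF pos_def_g])
  fix w assume x: "x \<in> U"
  have "dd w (\<lambda>x. form (g x) (n x) (n x)) x = dd w (\<lambda>_. - k) x"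
    by (rule dd_U_cong[OF x]) (rule norm_n)
  then have "form (g x) (cov_vec w n x) (n x) + form (g x) (n x) (cov_vec w n x) = 0"
    by (simp add: dd_form_cov[OF x smooth_n smooth_n])
  then have "form (g x) (cov_vec w n x) (n x) = 0"
    using form_sym[OF x, of "n x" "cov_vec w n x"] by simp
  then show "form (g x) (H x *v n x) w = form (g x) 0 w"
    using cov_n_sym[OF x, of w "n x"] form_sym[OF x, of w "cov_vec (n x) n x"] by (simp add: H_mv[OF x] form_simps)
qed

text \<open>Bochner's formula for \<open>n\<close>; there is no Laplacian term since \<open>n\<close> has constant length.\<close>

lemma bochner:
  assumes x: "x \<in> U"
  shows "trace (H x ** H x) = k\<^sup>2 * (2 * (f x)\<^sup>2 - 1)"
proof -
  have cc: "cov_vec u (cov_vec v n) x = cov u H x *v v + H x *v (Gam u x *v v)" for u v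
  proof -
    have "cov_vec u (cov_vec v n) x = cov_vec u (\<lambda>x. H x *v v) x"
      by (rule cov_vec_U_cong[OF x]) (simp add: H_mv)
    then show ?thesis by (simp add: cov_vec_mv[OF x smooth_H] cov_vec_const)
  qed
  have R: "Rm u v x *v n x = cov u H x *v v - cov v H x *v u" for u v
    using cov_vec_commute[OF x smooth_n, of u v] torsion_free[OF x, of u v] by (simp add: cc)
  \<comment> \<open>From differentiating \<open>H n = 0\<close>; this is where the constant length
    of \<open>n\<close> replaces the Laplacian term.\<close>
  have dH: "cov w H x *v n x = - (H x *v (H x *v w))" for w
  proof -
    have "cov_vec w (\<lambda>x. H x *v n x) x = cov_vec w (\<lambda>_. 0) x"
      by (rule cov_vec_U_cong[OF x]) (rule H_n)
    then show ?thesis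
      by (simp add: cov_vec_mv[OF x smooth_H smooth_n] cov_vec_const H_mv[OF x, symmetric] eq_neg_iff_add_eq_0)
  qed
  have "form (ricci g x) (n x) (n x) = - trace (H x ** H x) - trace (cov (n x) H x)"
    by (simp add: ricci_Rm[OF x] R dH trace_eq_sum_mv mv_simps sum_subtractf sum_negf)
  moreover have "trace (cov (n x) H x) = 2 * k\<^sup>2 * (1 - (f x)\<^sup>2)"
  proof -
    have "trace (cov (n x) H x) = dd (n x) (\<lambda>x. trace (H x)) x" by (rule trace_cov[OF x smooth_H])
    also have "\<dots> = dd (n x) (\<lambda>x. (- 2 * k) * f x) x"
      by (rule dd_U_cong[OF x]) (simp add: trace_H)
    also have "\<dots> = (- 2 * k) * dd (n x) f x"
      using dd_mult[OF x smooth_on_const smooth_f, of "n x" "- 2 * k"] by simp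
    finally show ?thesis using norm_n[OF x] by (simp add: dd_f[OF x] power2_eq_square)
  qed
  moreover have "form (ricci g x) (n x) (n x) = - k\<^sup>2"
    using norm_n[OF x] by (simp add: einstein[OF x] form_scaleR_matrix power2_eq_square)
  ultimately show ?thesis by (simp add: algebra_simps)
qed

lemma ricci_flat:
  assumes x: "x \<in> U"
  shows "k = 0"
proof (rule ccontr)
  assume k: "k \<noteq> 0"
  obtain S :: "real^4^4" where S: "\<And>x' y. form (g x) (S *v x') (S *v y) = x' \<bullet> y"
    using orthonormal_frame[OF pos_def_g[OF x] JJ[OF x] orthJ[OF x]] by blast
  have "(trace (H x))\<^sup>2 \<le> 4 * trace (H x ** H x)"
    by (rule trace_square_symmetric[OF S]) (simp add: H_mv[OF x] cov_n_sym[OF x])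
  then have "4 * (k\<^sup>2 * (f x)\<^sup>2) \<le> 4 * (k\<^sup>2 * (2 * (f x)\<^sup>2 - 1))"
    by (simp add: trace_H[OF x] bochner[OF x] power_mult_distrib)
  then have "0 \<le> k\<^sup>2 * ((f x)\<^sup>2 - 1)" by (simp add: algebra_simps)
  moreover have "k\<^sup>2 * ((f x)\<^sup>2 - 1) < 0" using k f_lt[OF x] by (simp add: mult_pos_neg)
  ultimately show False by simp
qed

lemma parallel: "x \<in> U \<Longrightarrow> cov w J' x = 0"
  using norm_n[of x] ricci_flat[of x] cov_J'[of x w] pos_def.form_self_eq_0[OF pos_def_g, of x "n x"]
  by (simp add: form_simps)

end


section \<open>Globalization\<close>

context kaehler_pair begin

lemma restrict:
  assumes "open V" "V \<subseteq> U"
  shows "kaehler_pair V g J J' k"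
  using assms smooth_on_subset[OF smooth_g assms(2)] smooth_on_subset[OF smooth_J assms(2)]
    smooth_on_subset[OF K'.smooth_J assms(2)] pos_def_g JJ orthJ closed integrable
    K'.JJ K'.orthJ K'.closed anticomm einstein
  by unfold_locales (auto simp: subset_iff pos_def_def)

lemma open_f_preimage: "open T \<Longrightarrow> open (U \<inter> f -` T)"
  by (rule continuous_open_preimage[OF smooth_on_continuous[OF smooth_f] open_U])

text \<open>As \<open>f^2 \<le> 1\<close> throughout, \<open>f^2 \<noteq> 1\<close> means
  \<open>f^2 < 1\<close>, an open condition, and the set it defines is a chart domain to which the
  previous section applies.\<close>

lemma generic_point:
  assumes x: "x \<in> U" and fx: "(f x)\<^sup>2 \<noteq> 1"
  shows "k = 0" "cov w J' x = 0"
proof -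
  define V where "V = U \<inter> f -` {t. t\<^sup>2 < 1}"
  have xV: "x \<in> V"
    using acs_pair.f_le_1[OF acs_pair[OF x]] x fx by (simp add: V_def)
  have "open V" unfolding V_def by (intro open_f_preimage open_Collect_less continuous_intros)
  then interpret V: kaehler_pair V g J J' k by (rule restrict) (auto simp: V_def)
  interpret V: kaehler_pair_generic V g J J' k
    by unfold_locales (auto simp: V_def)
  show "k = 0" "cov w J' x = 0" using V.ricci_flat[OF xV] V.parallel[OF xV] by auto
qed

lemma eq_or_eq_minus: "x \<in> U \<Longrightarrow> (f x)\<^sup>2 = 1 \<Longrightarrow> J' x = f x *\<^sub>R J x"
  by (rule acs_pair.eq_or_eq_minus[OF acs_pair])

lemma f_eq_of_eq: "x \<in> U \<Longrightarrow> J' x = s *\<^sub>R J x \<Longrightarrow> f x = s"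
  using acs_pair.tr_JJ(1)[OF acs_pair] by (simp add: f_def mm_simps trace_scaleR)

text \<open>Near a point where \<open>\<nabla>J' \<noteq> 0\<close> the two structures would agree up to a constant sign.\<close>

lemma parallel':
  assumes x: "x \<in> U"
  shows "cov w J' x = 0"
proof (rule ccontr)
  assume nz: "cov w J' x \<noteq> 0"
  \<comment> \<open>On the first set \<open>f^2 = 1\<close> by \<open>generic_point\<close>; the
    second one keeps the sign of \<open>f\<close>, so that \<open>f\<close> is constant on
    \<open>W\<close>.\<close>
  define W where "W = (U \<inter> cov w J' -` (- {0})) \<inter> (U \<inter> f -` {t. t * f x > 0})"
  have "open (U \<inter> cov w J' -` (- {0}))"
    by (rule continuous_open_preimage[OF smooth_on_continuous[OF smooth_cov[OF K'.smooth_J]] open_U]) auto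
  moreover have "open (U \<inter> f -` {t. t * f x > 0})"
    by (intro open_f_preimage open_Collect_less continuous_intros)
  ultimately have "open W" unfolding W_def by (rule open_Int)
  have sq: "(f y)\<^sup>2 = 1" if "y \<in> U" "cov w J' y \<noteq> 0" for y
    using generic_point(2)[OF that(1)] that(2) by blast
  have xW: "x \<in> W" using x nz sq[OF x nz] by (auto simp: W_def power2_eq_square)
  have "J' y = f x *\<^sub>R J y" if "y \<in> W" for y
  proof -
    have y: "y \<in> U" "cov w J' y \<noteq> 0" "f y * f x > 0" using that by (auto simp: W_def)
    have "f y = 1 \<or> f y = -1" "f x = 1 \<or> f x = -1" using sq y x nz by (auto simp: power2_eq_1_iff)
    then have "f y = f x" using y(3) by auto
    then show ?thesis using eq_or_eq_minus[OF y(1) sq[OF y(1,2)]] by simp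
  qed
  then have "cov w J' x = cov w (\<lambda>y. f x *\<^sub>R J y) x"
    using dd_cong[OF \<open>open W\<close> xW, of J' "\<lambda>y. f x *\<^sub>R J y"] xW by (simp add: cov_def)
  also have "\<dots> = 0"
    using cov_scaleR[OF x smooth_on_const smooth_J, of w "f x"] cov_J[OF x] by simp
  finally show False using nz by simp
qed

lemma integrable': "x \<in> U \<Longrightarrow> nijenhuis J' (\<lambda>_. axis i 1) (\<lambda>_. axis j 1) x = 0"
  by (subst nijenhuis_cov[OF _ K'.smooth_J K'.JJ]) (simp_all add: parallel')

lemma sign_dichotomy:
  assumes "k \<noteq> 0" "x \<in> U"
  shows "J' x = J x \<or> J' x = - J x"
proof -
  have "(f x)\<^sup>2 = 1" using generic_point(1)[OF assms(2)] assms(1) by blast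
  then show ?thesis using eq_or_eq_minus[OF assms(2)] by (auto simp: power2_eq_1_iff)
qed

text \<open>The equation looks like a closed condition, but for \<open>k \<noteq> 0\<close> the
  function \<open>f\<close> takes only the values 1 and -1, so it amounts to \<open>f\<close> having
  the sign of \<open>s\<close>. Connectedness will be applied to these sets.\<close>

lemma open_sign:
  assumes "k \<noteq> 0" "s = 1 \<or> s = -1"
  shows "open {x \<in> U. J' x = s *\<^sub>R J x}"
proof -
  have "{x \<in> U. J' x = s *\<^sub>R J x} = U \<inter> f -` {t. t * s > 0}"
  proof (intro set_eqI iffI; clarsimp)
    fix x assume x: "x \<in> U"
    { assume "J' x = s *\<^sub>R J x" then show "f x * s > 0" using f_eq_of_eq[OF x, of s] assms(2) by auto }
    { assume p: "f x * s > 0"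
      have sq: "(f x)\<^sup>2 = 1" using generic_point(1)[OF x] assms(1) by blast
      then have "f x = s" using p assms(2) by (auto simp: power2_eq_1_iff)
      then show "J' x = s *\<^sub>R J x" using eq_or_eq_minus[OF x sq] by simp }
  qed
  also have "open \<dots>" by (intro open_f_preimage open_Collect_less continuous_intros)
  finally show ?thesis .
qed

end

section \<open>From charts to the manifold\<close>

lemma kaehler_pair_chart:
  assumes ke: "kaehler_einstein_surface M A g J"
    and pos: "positive_acs A ori J" and ak': "orthogonal_almost_kaehler A g J'" and pos': "positive_acs A ori J'"
    and ein: "\<forall>c\<in>A. \<forall>x\<in>coords c. ricci (g c) x = k *\<^sub>R g c x" and c: "c \<in> A"
  shows "kaehler_pair (coords c) (g c) (J c) (J' c) k"
proof -
  have metric: "riemannian_metric A g" and ak: "orthogonal_almost_kaehler A g J" and int: "integrable_acs A J"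
    and man: "smooth_four_manifold M A"
    using ke by (auto simp: kaehler_einstein_surface_def kaehler_def)
  have pd: "pos_def (g c x)" if "x \<in> coords c" for x
    using metric c that by (auto simp: riemannian_metric_def pos_def_def)
  have "open_domain (coords c)"
    using man c by (auto simp: smooth_four_manifold_def is_chart_def open_domain_def)
  then have riem: "riem_chart (coords c) (g c)"
    using metric c pd
    by (auto simp: riem_chart_def riem_chart_axioms_def riemannian_metric_def covariant_tensor_def)
  have akc: "almost_kaehler_chart (coords c) (g c) (K c)" if K: "orthogonal_almost_kaehler A g K" for K
  proof -
    have "fundamental_form g K c = (\<lambda>x. \<chi> i j. form (g c x) (K c x *v axis i 1) (axis j 1))"
      by (rule ext) (simp add: fundamental_form_def)
    then show ?thesis
      using riem K c
      by (auto simp: almost_kaehler_chart_def almost_kaehler_chart_axioms_def orthogonal_almost_kaehler_def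
          almost_complex_def endomorphism_field_def orthogonal_acs_def closed_form2_def)
  qed
  have "\<exists>f. \<forall>v. J c x *v (J' c x *v v) + J' c x *v (J c x *v v) = - (2 * f) *\<^sub>R v" if x: "x \<in> coords c" for x
  proof -
    interpret K: almost_kaehler_chart "coords c" "g c" "J c" by (rule akc[OF ak])
    interpret K': almost_kaehler_chart "coords c" "g c" "J' c" by (rule akc[OF ak'])
    have o: "sgn (det (vector [u, K c x *v u, v, K c x *v v] :: real^4^4)) = ori c x"
      if "positive_acs A ori K" "det (vector [u, K c x *v u, v, K c x *v v] :: real^4^4) \<noteq> 0" for K u v
      using that c x unfolding positive_acs_def Let_def by blast
    show ?thesis
      using same_orientation_anticommutator[OF pd[OF x] K.JJ[OF x] K.orthJ[OF x] K'.JJ[OF x] K'.orthJ[OF x]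
          o[OF pos] o[OF pos']] by metis
  qed
  moreover have "kaehler_chart (coords c) (g c) (J c)"
    using akc[OF ak] int c by (auto simp: kaehler_chart_def kaehler_chart_axioms_def integrable_acs_def)
  ultimately show ?thesis
    using akc[OF ak'] ein c by (auto simp: kaehler_pair_def kaehler_pair_axioms_def)
qed

lemma chart_preimage_open:
  assumes "is_chart M c" "open W"
  shows "openin M {p \<in> fst c. snd c p \<in> coords c \<inter> W}"
proof -
  have sub: "fst c \<subseteq> topspace M" and op: "openin M (fst c)"
    using assms(1) by (auto simp: is_chart_def openin_subset)
  have "continuous_map (subtopology M (fst c)) (top_of_set (coords c)) (snd c)"
    using assms(1) homeomorphic_imp_continuous_map unfolding is_chart_def by blast
  then have "openin (subtopology M (fst c)) {p \<in> topspace (subtopology M (fst c)). snd c p \<in> coords c \<inter> W}"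
    using assms(2) by (intro openin_continuous_map_preimage) (auto simp: openin_open)
  moreover have "topspace (subtopology M (fst c)) = fst c" using sub by auto
  ultimately have "openin (subtopology M (fst c)) {p \<in> fst c. snd c p \<in> coords c \<inter> W}" by (simp only:)
  then show ?thesis using op by (rule openin_trans_full)
qed

lemma transition_eq:
  assumes "is_chart M c" "p \<in> fst c"
  shows "transition c c' (snd c p) = snd c' p"
proof -
  have "fst c \<subseteq> topspace M" using assms(1) by (auto simp: is_chart_def openin_subset)
  then have "inj_on (snd c) (fst c)"
    using assms(1) homeomorphic_imp_injective_map[of "subtopology M (fst c)" _ "snd c"]
    by (auto simp: is_chart_def Int_absorb1)
  then show ?thesis using assms(2) by (simp add: transition_def)
qed

text \<open>\<open>J\<close> and \<open>J'\<close> transform with the same Jacobian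
  \<open>T\<close>, so opposite signs in two charts give \<open>J T = - J T\<close> and hence
  \<open>T = 0\<close>, whereas covariance of the metric prevents \<open>T\<close> from killing a
  nonzero vector.\<close>

lemma sign_consistent:
  assumes ke: "kaehler_einstein_surface M A g J" and ak': "orthogonal_almost_kaehler A g J'"
    and c: "c \<in> A" "p \<in> fst c" "J' c (snd c p) = J c (snd c p)"
    and c': "c' \<in> A" "p \<in> fst c'" "J' c' (snd c' p) = - J c' (snd c' p)"
  shows False
proof -
  let ?x = "snd c p" and ?x' = "snd c' p"
  let ?T = "transition_jacobian c c' ?x"
  have man: "smooth_four_manifold M A" and metric: "riemannian_metric A g" and ak: "orthogonal_almost_kaehler A g J"
    using ke by (auto simp: kaehler_einstein_surface_def kaehler_def)
  have tr: "transition c c' ?x = ?x'"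
    using man c transition_eq[of M c p c'] by (auto simp: smooth_four_manifold_def)
  have ov: "?x \<in> overlap c c'" using c c' by (auto simp: overlap_def)
  have x: "?x \<in> coords c" and x': "?x' \<in> coords c'" using c c' by (auto simp: coords_def)
  have TJ: "?T *v (K c ?x *v v) = K c' ?x' *v (?T *v v)" if "orthogonal_almost_kaehler A g K" for K v
    using that c(1) c'(1) ov tr
    unfolding orthogonal_almost_kaehler_def almost_complex_def endomorphism_field_def by metis
  have "J c' ?x' *v (?T *v v) = 0" for v
  proof -
    have "J c' ?x' *v (?T *v v) = - (J c' ?x' *v (?T *v v))"
      using TJ[OF ak, of v] TJ[OF ak', of v] unfolding c(3) c'(3) mv_simps by metis
    then show ?thesis by (simp add: vec_eq_iff)
  qed
  moreover have "J c' ?x' *v (J c' ?x' *v v) = - v" for v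
    using ak c'(1) x' by (auto simp: orthogonal_almost_kaehler_def almost_complex_def)
  ultimately have T0: "?T *v v = 0" for v
    by (metis matrix_vector_mult_0_right neg_equal_0_iff_equal)
  have "form (g c ?x) v v = form (g c' ?x') (?T *v v) (?T *v v)" for v
    using metric c(1) c'(1) ov tr unfolding riemannian_metric_def covariant_tensor_def by metis
  then have "form (g c ?x) v v = 0" for v by (simp add: T0 form_simps)
  moreover have "form (g c ?x) (axis 1 1) (axis 1 1) > 0"
    using metric c(1) x by (auto simp: riemannian_metric_def axis_eq_0_iff)
  ultimately show False by simp
qed

theorem theorem1p1:
  fixes M :: "'a topology" and A :: "'a chart set"
    and g J J' :: "'a coefficients" and ori :: "'a chart \<Rightarrow> real^4 \<Rightarrow> real"
  assumes "kaehler_einstein_surface M A g J" and "connected_space M"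
    and "orientation A ori" and "positive_acs A ori J"
    and "orthogonal_almost_kaehler A g J'" and "positive_acs A ori J'"
  shows "integrable_acs A J' \<and>
    ((\<forall>c\<in>A. \<forall>x\<in>coords c. scalar_curvature (g c) x \<noteq> 0) \<longrightarrow>
       (\<forall>c\<in>A. \<forall>x\<in>coords c. J' c x = J c x) \<or> (\<forall>c\<in>A. \<forall>x\<in>coords c. J' c x = - J c x))"
proof -
  obtain k where ein: "\<forall>c\<in>A. \<forall>x\<in>coords c. ricci (g c) x = k *\<^sub>R g c x"
    using assms(1) by (auto simp: kaehler_einstein_surface_def einstein_def)
  have pair: "kaehler_pair (coords c) (g c) (J c) (J' c) k" if "c \<in> A" for c
    by (rule kaehler_pair_chart[OF assms(1,4,5,6) ein that])
  have charts: "is_chart M c" if "c \<in> A" for c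
    using assms(1) that by (auto simp: kaehler_einstein_surface_def smooth_four_manifold_def)
  have cover: "(\<Union>c\<in>A. fst c) = topspace M"
    using assms(1) by (auto simp: kaehler_einstein_surface_def smooth_four_manifold_def)
  have "integrable_acs A J'"
    unfolding integrable_acs_def using kaehler_pair.integrable'[OF pair] by blast
  moreover have "(\<forall>c\<in>A. \<forall>x\<in>coords c. J' c x = J c x) \<or> (\<forall>c\<in>A. \<forall>x\<in>coords c. J' c x = - J c x)"
    if scal: "\<forall>c\<in>A. \<forall>x\<in>coords c. scalar_curvature (g c) x \<noteq> 0"
  proof (cases "k = 0")
    case True
    \<comment> \<open>With \<open>k = 0\<close> the scalar curvature vanishes at every point, so the
      hypothesis leaves only charts without points.\<close>
    then have "coords c = {}" if "c \<in> A" for c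
      using scal ein that by (auto simp: scalar_curvature_def)
    then show ?thesis by blast
  next
    case False
    \<comment> \<open>The points at which \<open>J' = s J\<close> holds in some chart; that charts
      cannot disagree is \<open>sign_consistent\<close>, which makes \<open>P 1\<close> and
      \<open>P (-1)\<close> disjoint.\<close>
    define P where "P s = (\<Union>c\<in>A. {p \<in> fst c. snd c p \<in> coords c \<inter> {x \<in> coords c. J' c x = s *\<^sub>R J c x}})" for s
    have P: "p \<in> P s \<longleftrightarrow> (\<exists>c\<in>A. p \<in> fst c \<and> J' c (snd c p) = s *\<^sub>R J c (snd c p))" for p s
      by (auto simp: P_def coords_def)
    have opn: "openin M (P s)" if "s = 1 \<or> s = -1" for s
      unfolding P_def
    proof (rule openin_Union)
      fix K assume "K \<in> (\<lambda>c. {p \<in> fst c. snd c p \<in> coords c \<inter> {x \<in> coords c. J' c x = s *\<^sub>R J c x}}) ` A"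
      then obtain c where c: "c \<in> A"
        and K: "K = {p \<in> fst c. snd c p \<in> coords c \<inter> {x \<in> coords c. J' c x = s *\<^sub>R J c x}}"
        by (rule imageE)
      show "openin M K"
        unfolding K by (rule chart_preimage_open[OF charts[OF c] kaehler_pair.open_sign[OF pair[OF c] False that]])
    qed
    have dich: "J' c x = J c x \<or> J' c x = - J c x" if "c \<in> A" "x \<in> coords c" for c x
      using kaehler_pair.sign_dichotomy[OF pair[OF that(1)] False that(2)] .
    have "topspace M \<subseteq> P 1 \<union> P (-1)"
    proof
      fix p assume "p \<in> topspace M"
      then obtain c where "c \<in> A" "p \<in> fst c" using cover by blast
      moreover have "snd c p \<in> coords c" using \<open>p \<in> fst c\<close> by (auto simp: coords_def)
      ultimately show "p \<in> P 1 \<union> P (-1)" using dich by (fastforce simp: P)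
    qed
    moreover have "P 1 \<inter> P (-1) = {}"
      using sign_consistent[OF assms(1,5)] by (auto simp: P)
    ultimately have "P 1 = {} \<or> P (-1) = {}"
      using assms(2) opn unfolding connected_space_def by blast
    then show ?thesis
    proof
      assume e: "P 1 = {}"
      have "J' c x = - J c x" if cx: "c \<in> A" "x \<in> coords c" for c x
      proof -
        obtain p where "p \<in> fst c" "x = snd c p" using cx(2) by (auto simp: coords_def)
        then have "J' c x \<noteq> J c x" using e cx(1) P[of p 1] by auto
        then show ?thesis using dich[OF cx] by blast
      qed
      then show ?thesis by blast
    next
      assume e: "P (-1) = {}"
      have "J' c x = J c x" if cx: "c \<in> A" "x \<in> coords c" for c x
      proof -
        obtain p where "p \<in> fst c" "x = snd c p" using cx(2) by (auto simp: coords_def)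
        then have "J' c x \<noteq> - J c x" using e cx(1) P[of p "-1"] by auto
        then show ?thesis using dich[OF cx] by blast
      qed
      then show ?thesis by blast
    qed
  qed
  ultimately show ?thesis by blast
qed

end
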